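(* In the setting described in the context, let $\gamma_T^d>0$ be the downlink SINR threshold and let $$\mathsf{SINR}^d_T=\frac{P_{TBS}\,H^d_T\,d_T^{-\alpha_T}}{P_{ABS}\,G^d_T\,PL_a(Z_T)+\sigma^2}$$ be the downlink SINR at the TBS-supported user. Then $$\Pr(\mathsf{SINR}^d_T>\gamma_T^d)=\int_{\sqrt{R_2^2+h^2}}^{\sqrt{(R_1-d)^2+h^2}}\int_0^{2\pi}\mathcal L(s|z)e^{-s\sigma^2}f_\Omega(\omega|z)f_{Z_T}(z)\,d\omega\,dz+\int_{\sqrt{(R_1-d)^2+h^2}}^{\sqrt{(R_1+d)^2+h^2}}\int_{-\widehat\omega}^{\widehat\omega}\mathcal L(s|z)e^{-s\sigma^2}f_\Omega(\omega|z)f_{Z_T}(z)\,d\omega\,dz,$$ where $$s=s(z,\omega)=\frac{\gamma_T^d}{P_{TBS}}\left(z^2-h^2+d^2-2\sqrt{z^2-h^2}\,d\cos\omega\right)^{\alpha_T/2},$$ $$\mathcal L(s|z)=p_L(z)\,m_L^{m_L}\left(m_L+sP_{ABS}\eta_Lz^{-\alpha_L}\right)^{-m_L}+p_N(z)\,m_N^{m_N}\left(m_N+sP_{ABS}\eta_Nz^{-\alpha_N}\right)^{-m_N},$$ $\widehat\omega=\widehat\omega(z)=\mathrm{arcsec}\left(\frac{2d\sqrt{z^2-h^2}}{d^2+z^2-h^2-R_1^2}\right)$; for $\sqrt{R_2^2+h^2}\le z\le\sqrt{(R_1-d)^2+h^2}$, $f_{Z_T}(z)=\frac{2z}{R_1^2-R_2^2}$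 and $f_\Omega(\omega|z)=\frac1{2\pi}$; for $\sqrt{(R_1-d)^2+h^2}<z\le\sqrt{(R_1+d)^2+h^2}$, $f_{Z_T}(z)=\frac{2z\widehat\omega}{\pi(R_1^2-R_2^2)}$ and $f_\Omega(\omega|z)=\frac1{2\widehat\omega}$.
   Context: Geometry: a terrestrial base station (TBS) is at the center of a disk $\mathcal S_1$ of radius $R_1$ in the ground plane. A stadium is a disk $\mathcal S_2\subset\mathcal S_1$ of radius $R_2>0$ whose center is at distance $d>0$ from the TBS, with $d+R_2\le R_1$. An aerial base station (ABS) is at height $h>0$ above the center of $\mathcal S_2$. A TBS-supported user (TsUE) is uniformly distributed on $\mathcal S_1\setminus\mathcal S_2$; $Z_T$ is its 3-D Euclidean distance to the ABS and $d_T$ its distance to the TBS. Aerial link (ABS–TsUE): given the TsUE position with $Z_T=z$, the link is line-of-sight (LOS, index $L$) with probability $p_L(z)\in[0,1]$ and non-line-of-sight (NLOS, index $N$) with probability $p_N(z)=1-p_L(z)$, where $p_L$ is a given measurable function. In state $k\in\{L,N\}$ the path-loss is $PL_a(z)=\eta_kz^{-\alpha_k}$ ($\eta_k,\alpha_k>0$, $\eta_L>\eta_N$), and the Nakagami fading power gain $G^d_T$ is Gamma distributed with shape $m_k>0$ and mean $1$. Terrestrial link (TBS–TsUE): path-loss exponent $\alpha_T>0$, Rayleigh fading power gain $H^d_T$ exponential with unit mean, independent of the position, the link state and $G^d_T$; given the link state, $G^d_T$ is independent of the position. The TBS and ABS transmit with constant powers $P_{TBS},P_{ABS}>0$. Noise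 power is $\sigma^2>0$. Convention: $\mathrm{arcsec}(x)=\arccos(1/x)\in[0,\pi]$, with $\mathrm{arcsec}(2dr/0)=\pi/2$. *)

theory Defs
  imports "HOL-Probability.Probability"
begin

datatype link_state = LOS | NLOS

text \<open>
  Ground plane: \<open>real^2\<close>; three-dimensional space: \<open>(real^2) \<times> real\<close>, whose product
  metric is the Euclidean one.  The aerial base station sits at height \<open>h\<close> above the
  point \<open>c\<close> of the ground plane.
\<close>
definition abs_dist :: "real^2 \<Rightarrow> real \<Rightarrow> real^2 \<Rightarrow> real" where
  "abs_dist c h x = dist (x, 0::real) (c, h)"

definition path_loss ::
  "(link_state \<Rightarrow> real) \<Rightarrow> (link_state \<Rightarrow> real) \<Rightarrow> link_state \<Rightarrow> real \<Rightarrow> real" where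
  "path_loss \<eta> \<alpha> k z = \<eta> k * z powr (- \<alpha> k)"

definition SINR :: "real \<Rightarrow> real \<Rightarrow> real \<Rightarrow> real \<Rightarrow> real \<Rightarrow> real \<Rightarrow> real \<Rightarrow> real \<Rightarrow> real" where
  "SINR P_TBS P_ABS \<sigma> \<alpha>T H dT G PL =
     P_TBS * H * dT powr (- \<alpha>T) / (P_ABS * G * PL + \<sigma>\<^sup>2)"

text \<open>Gamma density with shape \<open>a\<close> and rate \<open>b\<close>; the mean is \<open>a / b\<close>, so mean \<open>1\<close> means \<open>b = a\<close>.\<close>
definition gamma_density :: "real \<Rightarrow> real \<Rightarrow> real \<Rightarrow> real" where
  "gamma_density a b x =
     (if x > 0 then b powr a / Gamma a * x powr (a - 1) * exp (- b * x) else 0)"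

lemma nn_integral_powr_mult_exp:
  fixes s b :: real
  assumes s: "s > 0" and b: "b > 0"
  shows "(\<integral>\<^sup>+x. ennreal (indicator {0<..} x * (b powr s / Gamma s * x powr (s - 1) * exp (- b * x))) \<partial>lborel) = 1"
proof -
  let ?g = "\<lambda>t::real. ennreal (indicator {0..} t * t powr (s - 1) / exp t)"
  have G: "Gamma s > 0"
    using s by (rule Gamma_real_pos)
  have "ennreal (Gamma s) = (\<integral>\<^sup>+t. ?g t \<partial>lborel)"
    by (rule Gamma_conv_nn_integral_real[OF s])
  also have "\<dots> = ennreal b * (\<integral>\<^sup>+x. ?g (0 + b * x) \<partial>lborel)"
    using b by (subst nn_integral_real_affine[where c = b and t = 0]) auto
  also have "\<dots> = (\<integral>\<^sup>+x. ennreal b * ?g (b * x) \<partial>lborel)"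
    by (simp add: nn_integral_cmult)
  also have "\<dots> = (\<integral>\<^sup>+x. ennreal (Gamma s) *
      ennreal (indicator {0<..} x * (b powr s / Gamma s * x powr (s - 1) * exp (- b * x))) \<partial>lborel)"
  proof (rule nn_integral_cong)
    fix x :: real
    have "b * (b * x) powr (s - 1) = b powr s * x powr (s - 1)" if "x > 0"
      using that b by (simp add: powr_mult powr_diff)
    then show "ennreal b * ?g (b * x) = ennreal (Gamma s) *
        ennreal (indicator {0<..} x * (b powr s / Gamma s * x powr (s - 1) * exp (- b * x)))"
      using b G by (cases "x > 0"; cases "x = 0")
        (simp_all add: ennreal_mult' [symmetric] indicator_def exp_minus divide_inverse
          zero_le_mult_iff mult.assoc [symmetric])
  qed
  also have "\<dots> = ennreal (Gamma s) *
      (\<integral>\<^sup>+x. ennreal (indicator {0<..} x * (b powr s / Gamma s * x powr (s - 1) * exp (- b * x))) \<partial>lborel)"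
    by (simp add: nn_integral_cmult)
  finally show ?thesis
    using G ennreal_mult_cancel_left[of "ennreal (Gamma s)" 1] by (auto simp: ennreal_eq_0_iff)
qed

lemma gamma_density_total:
  assumes "a > 0" "b > 0"
  shows "(\<integral>\<^sup>+x. ennreal (gamma_density a b x) \<partial>lborel) = 1"
  unfolding nn_integral_powr_mult_exp[OF assms, symmetric]
  by (rule nn_integral_cong) (simp add: gamma_density_def)

lemma gamma_density_mean:
  assumes a: "a > 0" and b: "b > 0"
  shows "(\<integral>\<^sup>+x. ennreal (x * gamma_density a b x) \<partial>lborel) = ennreal (a / b)"
proof -
  let ?f = "\<lambda>x. ennreal (indicator {0<..} x *
    (b powr (a + 1) / Gamma (a + 1) * x powr (a + 1 - 1) * exp (- b * x)))"
  have G: "Gamma (a + 1) = a * Gamma a"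
    using a by (intro Gamma_plus1) (auto simp: nonpos_Ints_def)
  have "(\<integral>\<^sup>+x. ennreal (x * gamma_density a b x) \<partial>lborel) = (\<integral>\<^sup>+x. ennreal (a / b) * ?f x \<partial>lborel)"
  proof (rule nn_integral_cong)
    fix x :: real
    have "x * x powr (a - 1) = x powr a" if "x > 0"
      using that by (simp add: powr_diff)
    then have "x * gamma_density a b x = a / b * (indicator {0<..} x *
        (b powr (a + 1) / Gamma (a + 1) * x powr (a + 1 - 1) * exp (- b * x)))"
      using a b by (simp add: gamma_density_def G powr_add)
    then show "ennreal (x * gamma_density a b x) = ennreal (a / b) * ?f x"
      using a b by (simp add: ennreal_mult' [symmetric])
  qed
  also have "\<dots> = ennreal (a / b)"
    using nn_integral_powr_mult_exp[of "a + 1" b] a b by (subst nn_integral_cmult) auto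
  finally show ?thesis .
qed

text \<open>
  Independence of two random variables with values in possibly different types, i.e. of the
  sigma algebras they generate; \<open>indep_var\<close> requires both to have the same type.
\<close>
definition indep_rv ::
  "'a measure \<Rightarrow> 'b measure \<Rightarrow> ('a \<Rightarrow> 'b) \<Rightarrow> 'c measure \<Rightarrow> ('a \<Rightarrow> 'c) \<Rightarrow> bool" where
  "indep_rv M A X B Y \<longleftrightarrow>
     prob_space.indep_set M
       (sets (vimage_algebra (space M) X A)) (sets (vimage_algebra (space M) Y B))"

text \<open>Since division by zero yields zero, \<open>arcsec (x / 0) = pi / 2\<close>, as in the lemma below.\<close>
definition arcsec :: "real \<Rightarrow> real" where
  "arcsec x = arccos (1 / x)"

lemma arcsec_div_0: "arcsec (x / 0) = pi / 2"
  by (simp add: arcsec_def)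

definition omega_hat :: "real \<Rightarrow> real \<Rightarrow> real \<Rightarrow> real \<Rightarrow> real" where
  "omega_hat R1 d h z = arcsec (2 * d * sqrt (z\<^sup>2 - h\<^sup>2) / (d\<^sup>2 + z\<^sup>2 - h\<^sup>2 - R1\<^sup>2))"

definition f_Z :: "real \<Rightarrow> real \<Rightarrow> real \<Rightarrow> real \<Rightarrow> real \<Rightarrow> real" where
  "f_Z R1 R2 d h z =
     (if sqrt (R2\<^sup>2 + h\<^sup>2) \<le> z \<and> z \<le> sqrt ((R1 - d)\<^sup>2 + h\<^sup>2)
        then 2 * z / (R1\<^sup>2 - R2\<^sup>2)
      else if sqrt ((R1 - d)\<^sup>2 + h\<^sup>2) < z \<and> z \<le> sqrt ((R1 + d)\<^sup>2 + h\<^sup>2)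
        then 2 * z * omega_hat R1 d h z / (pi * (R1\<^sup>2 - R2\<^sup>2))
      else 0)"

definition f_Omega :: "real \<Rightarrow> real \<Rightarrow> real \<Rightarrow> real \<Rightarrow> real \<Rightarrow> real \<Rightarrow> real" where
  "f_Omega R1 R2 d h \<omega> z =
     (if sqrt (R2\<^sup>2 + h\<^sup>2) \<le> z \<and> z \<le> sqrt ((R1 - d)\<^sup>2 + h\<^sup>2)
        then 1 / (2 * pi)
      else if sqrt ((R1 - d)\<^sup>2 + h\<^sup>2) < z \<and> z \<le> sqrt ((R1 + d)\<^sup>2 + h\<^sup>2)
        then 1 / (2 * omega_hat R1 d h z)
      else 0)"

definition laplace_arg :: "real \<Rightarrow> real \<Rightarrow> real \<Rightarrow> real \<Rightarrow> real \<Rightarrow> real \<Rightarrow> real \<Rightarrow> real" where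
  "laplace_arg \<gamma> P_TBS \<alpha>T d h z \<omega> =
     \<gamma> / P_TBS * (z\<^sup>2 - h\<^sup>2 + d\<^sup>2 - 2 * sqrt (z\<^sup>2 - h\<^sup>2) * d * cos \<omega>) powr (\<alpha>T / 2)"

definition interference_laplace ::
  "(real \<Rightarrow> real) \<Rightarrow> (link_state \<Rightarrow> real) \<Rightarrow> (link_state \<Rightarrow> real) \<Rightarrow> (link_state \<Rightarrow> real)
    \<Rightarrow> real \<Rightarrow> real \<Rightarrow> real \<Rightarrow> real" where
  "interference_laplace pL m \<eta> \<alpha> P_ABS s z =
     pL z * m LOS powr m LOS *
       (m LOS + s * P_ABS * \<eta> LOS * z powr (- \<alpha> LOS)) powr (- m LOS) +
     (1 - pL z) * m NLOS powr m NLOS *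
       (m NLOS + s * P_ABS * \<eta> NLOS * z powr (- \<alpha> NLOS)) powr (- m NLOS)"

end

theory Submission
  imports Defs
begin

text \<open>
  Since \<open>H\<close> is a unit exponential variable independent of everything else, the conditional probability
  that the SINR exceeds the threshold is \<open>exp (- s (P_ABS G PL + \<sigma>\<^sup>2))\<close> with \<open>s\<close> depending on the
  position only. Averaging over \<open>G\<close> given the link state gives the Laplace transform of a gamma
  variable, and averaging over the link state given the position replaces the indicator of line of
  sight by \<open>pL\<close>. What remains is the mean of a bounded function of the uniformly distributed position.
  It is computed in polar coordinates around the centre of the stadium; when the radius \<open>r\<close> is replaced
  by \<open>z = sqrt (r\<^sup>2 + h\<^sup>2)\<close> the Jacobian is \<open>z\<close>. Circles of radius \<open>r \<le> R1 - d\<close> lie inside the cell,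
  larger ones meet it in the arc \<open>\<bar>\<omega>\<bar> \<le> omega_hat\<close> by the law of cosines.
\<close>

section \<open>Averaging over the fading gains and the link state\<close>

text \<open>Preimages of measurable sets lie in the generated sigma algebras, so independence makes
  the joint law multiplicative on rectangles, and rectangles determine a product measure. This gives
  access to Fubini, for \<open>H\<close> against \<open>(X, K, G)\<close> and for \<open>G\<close>
  against \<open>X\<close>.\<close>

lemma indep_rv_distr_pair:
  assumes "prob_space M" and X [measurable]: "X \<in> measurable M A" and Y [measurable]: "Y \<in> measurable M B"
    and indep: "indep_rv M A X B Y"
  shows "distr M (A \<Otimes>\<^sub>M B) (\<lambda>x. (X x, Y x)) = distr M A X \<Otimes>\<^sub>M distr M B Y"
proof -
  interpret prob_space M by fact
  interpret DX: prob_space "distr M A X" by (rule prob_space_distr) fact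
  interpret DY: prob_space "distr M B Y" by (rule prob_space_distr) fact
  show ?thesis
  proof (rule pair_measure_eqI[symmetric])
    show "sets (distr M A X \<Otimes>\<^sub>M distr M B Y) = sets (distr M (A \<Otimes>\<^sub>M B) (\<lambda>x. (X x, Y x)))"
      by (simp cong: sets_pair_measure_cong)
    fix S T assume "S \<in> sets (distr M A X)" "T \<in> sets (distr M B Y)"
    then have S [measurable]: "S \<in> sets A" and T [measurable]: "T \<in> sets B" by simp_all
    have "X -` S \<inter> space M \<in> sets (vimage_algebra (space M) X A)"
      "Y -` T \<inter> space M \<in> sets (vimage_algebra (space M) Y B)"
      using S T by (auto intro: in_vimage_algebra)
    with indep have "prob ((X -` S \<inter> space M) \<inter> (Y -` T \<inter> space M)) =
        prob (X -` S \<inter> space M) * prob (Y -` T \<inter> space M)"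
      unfolding indep_rv_def by (intro indep_setD)
    moreover have "(\<lambda>x. (X x, Y x)) -` (S \<times> T) \<inter> space M = (X -` S \<inter> space M) \<inter> (Y -` T \<inter> space M)"
      by auto
    ultimately show "emeasure (distr M A X) S * emeasure (distr M B Y) T =
        emeasure (distr M (A \<Otimes>\<^sub>M B) (\<lambda>x. (X x, Y x))) (S \<times> T)"
      by (simp add: emeasure_distr emeasure_eq_measure ennreal_mult)
  qed (unfold_locales)
qed

lemma gamma_density_nonneg: "a > 0 \<Longrightarrow> gamma_density a b x \<ge> 0"
  by (auto simp: gamma_density_def intro!: mult_nonneg_nonneg divide_nonneg_pos Gamma_real_pos)

lemma borel_measurable_gamma_density [measurable]: "gamma_density a b \<in> borel_measurable borel"
  unfolding gamma_density_def[abs_def] by measurable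

text \<open>Tilting by \<open>exp (- (t * x))\<close> only shifts the rate from \<open>b\<close> to
  \<open>b + t\<close>. The constant is the ratio of the two normalisations, and the tilted density
  again has total mass 1.\<close>

lemma gamma_density_laplace:
  assumes a: "a > 0" and b: "b > 0" and t: "t \<ge> 0"
  shows "(\<integral>\<^sup>+x. ennreal (gamma_density a b x) * ennreal (exp (- (t * x))) \<partial>lborel) =
    ennreal (b powr a * (b + t) powr (- a))"
proof -
  have "(\<integral>\<^sup>+x. ennreal (gamma_density a b x) * ennreal (exp (- (t * x))) \<partial>lborel) =
      (\<integral>\<^sup>+x. ennreal (b powr a * (b + t) powr (- a)) * ennreal (gamma_density a (b + t) x) \<partial>lborel)"
  proof (rule nn_integral_cong)
    fix x
    have "gamma_density a b x * exp (- (t * x)) = b powr a * (b + t) powr (- a) * gamma_density a (b + t) x"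
      using b t by (simp add: gamma_density_def powr_minus field_simps flip: exp_add)
    then show "ennreal (gamma_density a b x) * ennreal (exp (- (t * x))) =
        ennreal (b powr a * (b + t) powr (- a)) * ennreal (gamma_density a (b + t) x)"
      using a by (simp add: gamma_density_nonneg flip: ennreal_mult)
  qed
  also have "\<dots> = ennreal (b powr a * (b + t) powr (- a))"
    using gamma_density_total[of a "b + t"] a b t by (simp add: nn_integral_cmult)
  finally show ?thesis .
qed

text \<open>The complementary distribution function of \<open>H\<close> turns the threshold event into a Laplace transform.\<close>
lemma exponential_exceeds_indep:
  assumes "prob_space M" and H: "distributed M lborel H (exponential_density 1)"
    and Y [measurable]: "Y \<in> measurable M B" and indep: "indep_rv M borel H B Y"
    and T [measurable]: "T \<in> borel_measurable B" and nonneg: "AE x in M. T (Y x) \<ge> 0"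
  shows "emeasure M {x \<in> space M. T (Y x) < H x} = (\<integral>\<^sup>+x. ennreal (exp (- T (Y x))) \<partial>M)"
proof -
  interpret prob_space M by fact
  have [measurable]: "H \<in> borel_measurable M"
    using distributed_measurable[OF H] by simp
  interpret DH: prob_space "distr M borel H" by (rule prob_space_distr) simp
  interpret DY: prob_space "distr M B Y" by (rule prob_space_distr) simp
  interpret P: pair_sigma_finite "distr M borel H" "distr M B Y" by unfold_locales
  \<comment> \<open>The tail formula is restricted to nonnegative levels; this is where the almost
    sure sign of \<open>T\<close> enters.\<close>
  have tail: "emeasure (distr M borel H) {t<..} = ennreal (exp (- t))" if "t \<ge> 0" for t
    using exponential_distributedD_gt[OF H that]
    by (simp add: emeasure_distr vimage_def Int_def emeasure_eq_measure conj_commute)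
  let ?A = "{p \<in> space (borel \<Otimes>\<^sub>M B). T (snd p) < fst p}"
  have A: "?A \<in> sets (borel \<Otimes>\<^sub>M B)" by measurable
  have "emeasure M {x \<in> space M. T (Y x) < H x} = emeasure (distr M (borel \<Otimes>\<^sub>M B) (\<lambda>x. (H x, Y x))) ?A"
    using A by (subst emeasure_distr) (auto intro!: arg_cong[where f = "emeasure M"]
        simp: space_pair_measure dest: measurable_space[OF Y])
  also have "\<dots> = emeasure (distr M borel H \<Otimes>\<^sub>M distr M B Y) ?A"
    by (subst indep_rv_distr_pair[OF assms(1) _ Y indep]) simp_all
  also have "\<dots> = (\<integral>\<^sup>+y. emeasure (distr M borel H) ((\<lambda>h. (h, y)) -` ?A) \<partial>distr M B Y)"
    by (rule P.emeasure_pair_measure_alt2) (use A in \<open>simp cong: sets_pair_measure_cong\<close>)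
  also have "\<dots> = (\<integral>\<^sup>+y. emeasure (distr M borel H) {T y<..} \<partial>distr M B Y)"
    by (intro nn_integral_cong arg_cong2[where f = emeasure]) (auto simp: space_pair_measure)
  also have "\<dots> = (\<integral>\<^sup>+y. ennreal (exp (- T y)) \<partial>distr M B Y)"
  proof (rule nn_integral_cong_AE)
    have "AE y in distr M B Y. T y \<ge> 0"
      using nonneg by (subst AE_distr_iff) simp_all
    then show "AE y in distr M B Y. emeasure (distr M borel H) {T y<..} = ennreal (exp (- T y))"
      by eventually_elim (rule tail)
  qed
  also have "\<dots> = (\<integral>\<^sup>+x. ennreal (exp (- T (Y x))) \<partial>M)"
    by (simp add: nn_integral_distr)
  finally show ?thesis .
qed

text \<open>Conditioned on \<open>A\<close>, the gain is gamma distributed and independent of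
  \<open>X\<close>, so it can be integrated first with \<open>X\<close> held fixed. In the
  application \<open>A\<close> is a link state, \<open>u\<close> the noise term and \<open>v\<close>
  the interference coefficient. A null event, on which conditioning is meaningless, is treated
  separately: both sides vanish.\<close>

lemma gamma_gain_laplace_on_event:
  assumes "prob_space M" and A [measurable]: "A \<in> sets M" and X [measurable]: "X \<in> measurable M borel"
    and G [measurable]: "G \<in> borel_measurable M" and m: "m > 0"
    and gamma: "measure M A > 0 \<Longrightarrow> distributed (uniform_measure M A) lborel G (gamma_density m m)"
    and indep: "measure M A > 0 \<Longrightarrow> indep_rv (uniform_measure M A) borel G borel X"
    and u [measurable]: "u \<in> borel_measurable borel"
    and v [measurable]: "v \<in> borel_measurable borel" and v0: "\<And>x. v x \<ge> 0"
  shows "(\<integral>\<^sup>+x. ennreal (exp (- (u (X x) + v (X x) * G x))) * indicator A x \<partial>M) =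
    (\<integral>\<^sup>+x. ennreal (exp (- u (X x)) * (m powr m * (m + v (X x)) powr (- m))) * indicator A x \<partial>M)" (is "?l = ?r")
proof (cases "measure M A = 0")
  interpret prob_space M by fact
  case True
  then have "AE x in M. x \<notin> A"
    by (intro AE_not_in) (simp add: null_sets_def emeasure_eq_measure)
  then show ?thesis
    by (intro nn_integral_cong_AE) (auto elim!: eventually_mono)
next
  interpret prob_space M by fact
  case False
  then have pos: "measure M A > 0" using zero_less_measure_iff by blast
  define N where "N = uniform_measure M A"
  have eA: "emeasure M A \<noteq> 0" using False by (simp add: emeasure_eq_measure)
  then have "prob_space N"
    unfolding N_def by (intro prob_space_uniform_measure) simp_all
  have sN [measurable_cong, simp]: "sets N = sets M" by (simp add: N_def)
  have XN: "X \<in> measurable N borel" and GN: "G \<in> measurable N borel" by measurable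
  interpret DX: prob_space "distr N borel X" by (rule prob_space.prob_space_distr) fact+
  interpret DG: prob_space "distr N borel G" by (rule prob_space.prob_space_distr) fact+
  interpret P: pair_sigma_finite "distr N borel G" "distr N borel X" by unfold_locales
  have dG: "distr N lborel G = density lborel (\<lambda>x. ennreal (gamma_density m m x))"
    using gamma[OF pos] by (simp add: distributed_def N_def)
  have dG': "distr N borel G = density lborel (\<lambda>x. ennreal (gamma_density m m x))"
    unfolding dG[symmetric] by (rule distr_cong) simp_all
  have exp_neg_add: "exp (- (a + b)) = exp (- a) * exp (- b)" for a b :: real
    by (simp flip: exp_add)
  let ?f = "\<lambda>p. ennreal (exp (- (u (snd p) + v (snd p) * fst p)))"
  have "(\<integral>\<^sup>+x. ?f (G x, X x) \<partial>N) = (\<integral>\<^sup>+p. ?f p \<partial>distr N (borel \<Otimes>\<^sub>M borel) (\<lambda>x. (G x, X x)))"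
    using XN GN by (subst nn_integral_distr) simp_all
  also have "\<dots> = (\<integral>\<^sup>+p. ?f p \<partial>(distr N borel G \<Otimes>\<^sub>M distr N borel X))"
    using indep_rv_distr_pair[OF \<open>prob_space N\<close> GN XN] indep[OF pos] by (simp add: N_def)
  also have "\<dots> = (\<integral>\<^sup>+x. (\<integral>\<^sup>+g. ?f (g, x) \<partial>distr N borel G) \<partial>distr N borel X)"
    by (rule P.nn_integral_snd[symmetric]) measurable
  also have "\<dots> = (\<integral>\<^sup>+x. ennreal (exp (- u x) * (m powr m * (m + v x) powr (- m))) \<partial>distr N borel X)"
  proof (rule nn_integral_cong)
    fix x
    have "(\<integral>\<^sup>+g. ?f (g, x) \<partial>distr N borel G) =
        (\<integral>\<^sup>+g. ennreal (exp (- u x)) * (ennreal (gamma_density m m g) * ennreal (exp (- (v x * g)))) \<partial>lborel)"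
      unfolding dG' exp_neg_add
      by (subst nn_integral_density)
        (auto intro!: nn_integral_cong simp: gamma_density_nonneg[OF m] mult_ac simp flip: ennreal_mult)
    also have "\<dots> = ennreal (exp (- u x) * (m powr m * (m + v x) powr (- m)))"
      using gamma_density_laplace[OF m m v0[of x]] by (simp add: nn_integral_cmult ennreal_mult)
    finally show "(\<integral>\<^sup>+g. ?f (g, x) \<partial>distr N borel G) = \<dots>" .
  qed
  also have "\<dots> = (\<integral>\<^sup>+x. ennreal (exp (- u (X x)) * (m powr m * (m + v (X x)) powr (- m))) \<partial>N)"
    using XN by (subst nn_integral_distr) simp_all
  finally have "(\<integral>\<^sup>+x. ?f (G x, X x) \<partial>N) = \<dots>" .
  \<comment> \<open>The uniform measure divides both integrals by \<open>emeasure M A\<close>.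
    Multiplying back is legitimate because this number is neither 0 nor infinite.\<close>
  then have "(\<integral>\<^sup>+x. ?f (G x, X x) * indicator A x \<partial>M) / emeasure M A =
      (\<integral>\<^sup>+x. ennreal (exp (- u (X x)) * (m powr m * (m + v (X x)) powr (- m))) * indicator A x \<partial>M) / emeasure M A"
    unfolding N_def by (subst (asm) (1 2) nn_integral_uniform_measure) simp_all
  then have "?l / emeasure M A * emeasure M A = ?r / emeasure M A * emeasure M A"
    by simp
  moreover have "emeasure M A / emeasure M A = 1"
    using eA by (intro ennreal_divide_self) (simp_all add: emeasure_eq_measure)
  ultimately show ?thesis
    by (simp add: ennreal_divide_times)
qed

text \<open>The gain is known only through its conditional laws, so its sign is available only
  almost everywhere: the gamma density vanishes off the positive half-line.\<close>

lemma distributed_gamma_pos: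
  assumes "prob_space M" and A [measurable]: "A \<in> sets M" and G [measurable]: "G \<in> borel_measurable M"
    and gamma: "measure M A > 0 \<Longrightarrow> distributed (uniform_measure M A) lborel G (gamma_density a b)"
  shows "AE x in M. x \<in> A \<longrightarrow> G x > 0"
proof (cases "measure M A = 0")
  interpret prob_space M by fact
  case True
  then have "AE x in M. x \<notin> A"
    by (intro AE_not_in) (simp add: null_sets_def emeasure_eq_measure)
  then show ?thesis by eventually_elim simp
next
  interpret prob_space M by fact
  case False
  then have "measure M A > 0" using zero_less_measure_iff by blast
  note D = gamma[OF this]
  have "AE y in distr (uniform_measure M A) lborel G. y > 0"
    unfolding distributed_distr_eq_density[OF D]
    by (subst AE_density) (auto simp: gamma_density_def)
  then have "AE x in uniform_measure M A. G x > 0"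
    by (subst (asm) AE_distr_iff) simp_all
  then show ?thesis
    using False by (subst (asm) AE_uniform_measure) (auto simp: emeasure_eq_measure less_top[symmetric] zero_less_measure_iff)
qed

section \<open>From the SINR event to a mean over the position\<close>

lemma gamma_laplace_le_1:
  assumes "m > 0" "v \<ge> 0"
  shows "m powr m * (m + v) powr (- m) \<le> (1::real)"
  using assms powr_mono2[of m m "m + v"] by (simp add: powr_minus field_simps)

text \<open>Clearing the positive denominator isolates \<open>H\<close>, whose tail is explicit.
  Strictness of \<open>dT > 0\<close> matters: since \<open>0 powr x\<close> is 0, at distance 0 the
  SINR would be 0 while the right-hand side would read \<open>0 < H\<close>.\<close>

lemma SINR_gt_iff:
  assumes "P_TBS > 0" "P_ABS > 0" "\<sigma> > 0" "dT > 0" "G \<ge> 0" "PL \<ge> 0"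
  shows "SINR P_TBS P_ABS \<sigma> \<alpha>T H dT G PL > \<gamma> \<longleftrightarrow>
    \<gamma> / P_TBS * dT powr \<alpha>T * (P_ABS * G * PL + \<sigma>\<^sup>2) < H"
proof -
  have I: "P_ABS * G * PL + \<sigma>\<^sup>2 > 0"
    using assms by (intro add_nonneg_pos) auto
  define D where "D = dT powr \<alpha>T * (P_ABS * G * PL + \<sigma>\<^sup>2)"
  have D: "D > 0" using I assms by (simp add: D_def)
  have "SINR P_TBS P_ABS \<sigma> \<alpha>T H dT G PL = H * P_TBS / D"
    by (simp add: SINR_def D_def powr_minus divide_inverse mult_ac)
  moreover have "\<gamma> / P_TBS * dT powr \<alpha>T * (P_ABS * G * PL + \<sigma>\<^sup>2) = \<gamma> * D / P_TBS"
    by (simp add: D_def)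
  moreover have "H * P_TBS / D > \<gamma> \<longleftrightarrow> \<gamma> * D / P_TBS < H"
    using assms(1) D by (simp add: pos_less_divide_eq pos_divide_less_eq)
  ultimately show ?thesis by (simp only:)
qed

text \<open>The factor \<open>B (X x)\<close> is measurable for the sigma algebra of
  \<open>X\<close>, so the characteristic property of conditional expectation lets
  \<open>q (X x)\<close> replace the indicator. The bound on \<open>B\<close> supplies
  integrability.\<close>

lemma expectation_indicator_eq_cond:
  assumes "prob_space M" and X [measurable]: "X \<in> measurable M borel" and A [measurable]: "A \<in> sets M"
    and cond: "AE x in M. real_cond_exp M (vimage_algebra (space M) X borel) (indicat_real A) x = q (X x)"
    and q [measurable]: "q \<in> borel_measurable borel"
    and B [measurable]: "B \<in> borel_measurable borel" and bnd: "\<And>x. \<bar>B x\<bar> \<le> (C::real)"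
  shows "(\<integral>x. B (X x) * indicator A x \<partial>M) = (\<integral>x. B (X x) * q (X x) \<partial>M)"
    and "integrable M (\<lambda>x. B (X x) * q (X x))"
proof -
  interpret prob_space M by fact
  let ?F = "vimage_algebra (space M) X borel"
  have "subalgebra M ?F"
    unfolding subalgebra_def using X by (auto simp: sets_vimage_algebra2 measurable_space intro: measurable_sets)
  then interpret finite_measure_subalgebra M ?F
    by unfold_locales
  have "X \<in> measurable ?F borel"
    by (rule measurable_vimage_algebra1) simp
  then have BX: "(\<lambda>x. B (X x)) \<in> borel_measurable ?F"
    by measurable
  have int: "integrable M (\<lambda>x. B (X x) * indicator A x)"
    by (rule integrable_const_bound[of _ C]) (use bnd in \<open>auto simp: indicator_def abs_mult intro: order_trans[OF abs_ge_zero]\<close>)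
  have eq: "AE x in M. B (X x) * real_cond_exp M ?F (indicat_real A) x = B (X x) * q (X x)"
    using cond by eventually_elim simp
  show "(\<integral>x. B (X x) * indicator A x \<partial>M) = (\<integral>x. B (X x) * q (X x) \<partial>M)"
    using real_cond_exp_intg(2)[OF int BX] integral_cong_AE[OF _ _ eq] by simp
  show "integrable M (\<lambda>x. B (X x) * q (X x))"
    using real_cond_exp_intg(1)[OF int BX] integrable_cong_AE[OF _ _ eq] by simp
qed


text \<open>This is the coverage probability at one fixed position. Keeping \<open>s\<close> as an
  argument lets the same expression serve in the plane, where \<open>s\<close> comes from the
  distance to the TBS, and in polar coordinates, where it is \<open>laplace_arg\<close>.\<close>

definition conditional_coverage ::
  "(real \<Rightarrow> real) \<Rightarrow> (link_state \<Rightarrow> real) \<Rightarrow> (link_state \<Rightarrow> real) \<Rightarrow> (link_state \<Rightarrow> real)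
    \<Rightarrow> real \<Rightarrow> real \<Rightarrow> real \<Rightarrow> real \<Rightarrow> real" where
  "conditional_coverage pL m \<eta> \<alpha> P_ABS \<sigma> s z =
     interference_laplace pL m \<eta> \<alpha> P_ABS s z * exp (- s * \<sigma>\<^sup>2)"

text \<open>Two numbers of the unit interval are averaged with weights \<open>pL z\<close> and
  \<open>1 - pL z\<close> and damped by a factor at most 1. The bound yields integrability over
  bounded regions.\<close>

lemma conditional_coverage_bounds:
  assumes "\<And>z. 0 \<le> pL z \<and> pL z \<le> 1" "\<And>k. \<eta> k > 0" "\<And>k. m k > 0" "P_ABS > 0" "s \<ge> 0"
  shows "\<bar>conditional_coverage pL m \<eta> \<alpha> P_ABS \<sigma> s z\<bar> \<le> 1"
proof -
  define g where "g k = m k powr m k * (m k + s * P_ABS * \<eta> k * z powr (- \<alpha> k)) powr (- m k)" for k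
  have g: "0 \<le> g k" "g k \<le> 1" for k
  proof -
    have "0 \<le> s * P_ABS * \<eta> k * z powr (- \<alpha> k)"
      using assms(2)[of k] assms(4,5) by simp
    from gamma_laplace_le_1[OF assms(3) this] show "0 \<le> g k" "g k \<le> 1"
      by (simp_all add: g_def)
  qed
  have I: "interference_laplace pL m \<eta> \<alpha> P_ABS s z = pL z * g LOS + (1 - pL z) * g NLOS"
    by (simp add: interference_laplace_def g_def mult.assoc)
  have "pL z * g LOS + (1 - pL z) * g NLOS \<le> pL z * 1 + (1 - pL z) * 1"
    using assms(1)[of z] g[of LOS] g[of NLOS] by (intro add_mono mult_left_mono) simp_all
  moreover have "0 \<le> pL z * g LOS + (1 - pL z) * g NLOS"
    using assms(1)[of z] g[of LOS] g[of NLOS] by (intro add_nonneg_nonneg mult_nonneg_nonneg) simp_all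
  ultimately have "\<bar>pL z * g LOS + (1 - pL z) * g NLOS\<bar> \<le> 1" by simp
  moreover have "\<bar>exp (- s * \<sigma>\<^sup>2)\<bar> \<le> 1" using assms(5) by simp
  ultimately show ?thesis
    unfolding conditional_coverage_def I abs_mult by (rule mult_le_one[OF _ abs_ge_zero])
qed

text \<open>Randomness is removed in the order \<open>H\<close>, \<open>G\<close>, \<open>K\<close>:
  exponential tail, gamma Laplace transform on each link-state event, conditional probability of
  line of sight. The law of \<open>X\<close> enters only through \<open>X x \<noteq> tbs\<close>;
  the geometry comes later.\<close>

lemma coverage_probability_eq_expectation:
  fixes X :: "'a \<Rightarrow> real^2" and K :: "'a \<Rightarrow> link_state" and G H :: "'a \<Rightarrow> real"
  assumes "prob_space M"
    and X [measurable]: "X \<in> borel_measurable M" and nontbs: "AE x in M. X x \<noteq> tbs"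
    and pL [measurable]: "pL \<in> borel_measurable borel"
    and pos: "\<And>k. \<eta> k > 0" "\<And>k. m k > 0" "P_TBS > 0" "P_ABS > 0" "\<sigma> > 0" "\<gamma> > 0"
    and K [measurable]: "K \<in> measurable M (count_space UNIV)"
    and cond: "AE x in M. real_cond_exp M (vimage_algebra (space M) X borel)
           (indicat_real {x \<in> space M. K x = LOS}) x = pL (abs_dist c h (X x))"
    and G [measurable]: "G \<in> borel_measurable M"
    and gamma: "\<And>k. measure M {x \<in> space M. K x = k} > 0 \<Longrightarrow>
           distributed (uniform_measure M {x \<in> space M. K x = k}) lborel G
             (gamma_density (m k) (m k))"
    and indep: "\<And>k. measure M {x \<in> space M. K x = k} > 0 \<Longrightarrow>
           indep_rv (uniform_measure M {x \<in> space M. K x = k}) borel G borel X"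
    and H: "distributed M lborel H (exponential_density 1)"
    and indepH: "indep_rv M borel H
           (borel \<Otimes>\<^sub>M count_space UNIV \<Otimes>\<^sub>M borel) (\<lambda>x. (X x, K x, G x))"
  shows "measure M {x \<in> space M.
           SINR P_TBS P_ABS \<sigma> \<alpha>T (H x) (dist (X x) tbs) (G x)
             (path_loss \<eta> \<alpha> (K x) (abs_dist c h (X x))) > \<gamma>} =
         (\<integral>x. conditional_coverage pL m \<eta> \<alpha> P_ABS \<sigma>
             (\<gamma> / P_TBS * dist (X x) tbs powr \<alpha>T) (abs_dist c h (X x)) \<partial>M)"
proof -
  interpret prob_space M by fact
  \<comment> \<open>\<open>T\<close> is the level that \<open>H\<close> has to exceed. In state
    \<open>k\<close> it is affine in the gain, with slope \<open>v k\<close> and constant term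
    \<open>s x * \<sigma>\<^sup>2\<close>; \<open>B k\<close> is what remains of
    \<open>exp (- T)\<close> once the gain is averaged out.\<close>
  define s where "s = (\<lambda>x. \<gamma> / P_TBS * dist x tbs powr \<alpha>T)"
  define v where "v = (\<lambda>k x. s x * P_ABS * path_loss \<eta> \<alpha> k (abs_dist c h x))"
  define T where "T = (\<lambda>(x, k, g). s x * (P_ABS * g * path_loss \<eta> \<alpha> k (abs_dist c h x) + \<sigma>\<^sup>2))"
  define A where "A = (\<lambda>k. {x \<in> space M. K x = k})"
  define B where "B = (\<lambda>k x. exp (- (s x * \<sigma>\<^sup>2)) * (m k powr m k * (m k + v k x) powr (- m k)))"
  let ?Y = "\<lambda>x. (X x, K x, G x)"
  have [measurable]: "H \<in> borel_measurable M"
    using distributed_measurable[OF H] by simp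
  have [measurable]: "A k \<in> sets M" for k
    unfolding A_def by measurable
  have [measurable]: "abs_dist c h \<in> borel_measurable borel"
    unfolding abs_dist_def[abs_def] dist_Pair_Pair by measurable
  have [measurable]: "s \<in> borel_measurable borel"
    unfolding s_def by measurable
  have [measurable]: "f \<in> borel_measurable (count_space UNIV)" for f :: "link_state \<Rightarrow> real"
    by simp
  have [measurable]: "v k \<in> borel_measurable borel" "B k \<in> borel_measurable borel" for k
    unfolding v_def B_def path_loss_def by measurable
  have T_meas [measurable]: "T \<in> borel_measurable (borel \<Otimes>\<^sub>M count_space UNIV \<Otimes>\<^sub>M borel)"
    unfolding T_def path_loss_def by measurable
  have s0: "s x \<ge> 0" for x
    using pos by (simp add: s_def)
  have PL0: "path_loss \<eta> \<alpha> k z \<ge> 0" for k z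
    using pos(1)[of k] by (simp add: path_loss_def)
  have v0: "v k x \<ge> 0" for k x
    using s0[of x] PL0[of k] pos by (simp add: v_def)
  have B0: "B k x \<ge> 0" for k x
    by (simp add: B_def)
  have B1: "B k x \<le> 1" for k x
    unfolding B_def using gamma_laplace_le_1[OF pos(2) v0] s0[of x] by - (rule mult_le_one, simp_all)
  have B_bnd: "\<bar>B k x\<bar> \<le> 1" for k x
    using B0[of k x] B1[of k x] by simp
  have G0: "AE x in M. G x > 0"
  proof -
    have "AE x in M. x \<in> A k \<longrightarrow> G x > 0" for k
      unfolding A_def by (rule distributed_gamma_pos[OF assms(1) _ _ gamma]) simp_all
    from this[of LOS] this[of NLOS] show ?thesis
      using AE_space
    proof eventually_elim
      case (elim x)
      then show ?case by (cases "K x") (auto simp: A_def)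
    qed
  qed
  have part: "(\<integral>\<^sup>+x. ennreal (exp (- T (?Y x))) * indicator (A k) x \<partial>M) = ennreal (\<integral>x. B k (X x) * indicator (A k) x \<partial>M)" for k
  proof -
    have "(\<integral>\<^sup>+x. ennreal (exp (- T (?Y x))) * indicator (A k) x \<partial>M) =
        (\<integral>\<^sup>+x. ennreal (exp (- (s (X x) * \<sigma>\<^sup>2 + v k (X x) * G x))) * indicator (A k) x \<partial>M)"
      by (intro nn_integral_cong) (auto simp: T_def v_def A_def indicator_def algebra_simps)
    also have "\<dots> = (\<integral>\<^sup>+x. ennreal (B k (X x)) * indicator (A k) x \<partial>M)"
      unfolding B_def
      by (rule gamma_gain_laplace_on_event[OF assms(1) _ _ _ pos(2)])
        (use gamma indep v0 in \<open>auto simp: A_def\<close>)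
    also have "\<dots> = (\<integral>\<^sup>+x. ennreal (B k (X x) * indicator (A k) x) \<partial>M)"
      by (intro nn_integral_cong) (auto simp: indicator_def)
    also have "\<dots> = ennreal (\<integral>x. B k (X x) * indicator (A k) x \<partial>M)"
      using B_bnd B0 by (intro nn_integral_eq_integral integrable_const_bound[of _ 1]) (auto simp: indicator_def)
    finally show ?thesis .
  qed
  have "emeasure M {x \<in> space M. SINR P_TBS P_ABS \<sigma> \<alpha>T (H x) (dist (X x) tbs) (G x)
             (path_loss \<eta> \<alpha> (K x) (abs_dist c h (X x))) > \<gamma>} = emeasure M {x \<in> space M. T (?Y x) < H x}"
  proof (rule emeasure_eq_AE)
    show "AE x in M. (x \<in> {x \<in> space M. SINR P_TBS P_ABS \<sigma> \<alpha>T (H x) (dist (X x) tbs) (G x)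
             (path_loss \<eta> \<alpha> (K x) (abs_dist c h (X x))) > \<gamma>}) = (x \<in> {x \<in> space M. T (?Y x) < H x})"
      using G0 nontbs
    proof eventually_elim
      case (elim x)
      then show ?case
        using SINR_gt_iff[of P_TBS P_ABS \<sigma> "dist (X x) tbs" "G x"] pos PL0 by (simp add: T_def s_def)
    qed
    show "{x \<in> space M. SINR P_TBS P_ABS \<sigma> \<alpha>T (H x) (dist (X x) tbs) (G x)
             (path_loss \<eta> \<alpha> (K x) (abs_dist c h (X x))) > \<gamma>} \<in> sets M"
      unfolding SINR_def path_loss_def by measurable
  qed measurable
  also have "\<dots> = (\<integral>\<^sup>+x. ennreal (exp (- T (?Y x))) \<partial>M)"
  proof (rule exponential_exceeds_indep[OF assms(1) H _ indepH T_meas])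
    show "AE x in M. T (?Y x) \<ge> 0"
      using G0 by eventually_elim (use s0 PL0 pos in \<open>auto simp: T_def\<close>)
  qed measurable
  also have "\<dots> = (\<integral>\<^sup>+x. ennreal (exp (- T (?Y x))) * indicator (A LOS) x
      + ennreal (exp (- T (?Y x))) * indicator (A NLOS) x \<partial>M)"
  proof (rule nn_integral_cong)
    fix x assume "x \<in> space M"
    then show "ennreal (exp (- T (?Y x))) = ennreal (exp (- T (?Y x))) * indicator (A LOS) x
      + ennreal (exp (- T (?Y x))) * indicator (A NLOS) x"
      by (cases "K x") (auto simp: A_def)
  qed
  also have "\<dots> = (\<integral>\<^sup>+x. ennreal (exp (- T (?Y x))) * indicator (A LOS) x \<partial>M)
      + (\<integral>\<^sup>+x. ennreal (exp (- T (?Y x))) * indicator (A NLOS) x \<partial>M)"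
    by (rule nn_integral_add) measurable
  also have "\<dots> = ennreal (\<integral>x. B LOS (X x) * indicator (A LOS) x \<partial>M) + ennreal (\<integral>x. B NLOS (X x) * indicator (A NLOS) x \<partial>M)"
    unfolding part ..
  also have "\<dots> =
      ennreal ((\<integral>x. B LOS (X x) * indicator (A LOS) x \<partial>M) + (\<integral>x. B NLOS (X x) * indicator (A NLOS) x \<partial>M))"
    using B0 by (intro ennreal_plus[symmetric] integral_nonneg) auto
  finally have split: "measure M {x \<in> space M. SINR P_TBS P_ABS \<sigma> \<alpha>T (H x) (dist (X x) tbs) (G x)
             (path_loss \<eta> \<alpha> (K x) (abs_dist c h (X x))) > \<gamma>} =
      (\<integral>x. B LOS (X x) * indicator (A LOS) x \<partial>M) + (\<integral>x. B NLOS (X x) * indicator (A NLOS) x \<partial>M)"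
    using B0 by (intro measure_eq_emeasure_eq_ennreal add_nonneg_nonneg integral_nonneg) simp_all
  have cond': "AE x in M. real_cond_exp M (vimage_algebra (space M) X borel) (indicat_real (A LOS)) x
      = (pL \<circ> abs_dist c h) (X x)"
    using cond by (simp add: A_def)
  have q: "pL \<circ> abs_dist c h \<in> borel_measurable borel"
    unfolding comp_def by measurable
  note E = expectation_indicator_eq_cond[OF assms(1) X _ cond' q, of "B k" 1 for k, simplified, OF B_bnd]
  have IB: "integrable M (\<lambda>x. B k (X x))" for k
    using B_bnd by (intro integrable_const_bound[of _ 1]) auto
  have IBA: "integrable M (\<lambda>x. B k (X x) * indicator (A l) x)" for k l
    using B_bnd B0 by (intro integrable_const_bound[of _ 1]) (auto simp: indicator_def)
  \<comment> \<open>Only line of sight has a prescribed conditional probability. The other state is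
    reached by complement: on \<open>space M\<close> its indicator is one minus that of
    \<open>A LOS\<close>.\<close>
  have "(\<integral>x. B NLOS (X x) * indicator (A NLOS) x \<partial>M) =
      (\<integral>x. B NLOS (X x) - B NLOS (X x) * indicator (A LOS) x \<partial>M)"
  proof (rule Bochner_Integration.integral_cong[OF refl])
    fix x assume "x \<in> space M"
    then show "B NLOS (X x) * indicator (A NLOS) x = B NLOS (X x) - B NLOS (X x) * indicator (A LOS) x"
      by (cases "K x") (auto simp: A_def)
  qed
  also have "\<dots> = (\<integral>x. B NLOS (X x) - B NLOS (X x) * pL (abs_dist c h (X x)) \<partial>M)"
    using IB IBA E by simp
  finally have "(\<integral>x. B LOS (X x) * indicator (A LOS) x \<partial>M) + (\<integral>x. B NLOS (X x) * indicator (A NLOS) x \<partial>M) =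
      (\<integral>x. B LOS (X x) * pL (abs_dist c h (X x))
        + (B NLOS (X x) - B NLOS (X x) * pL (abs_dist c h (X x))) \<partial>M)"
    using IB E by simp
  also have "\<dots> = (\<integral>x. conditional_coverage pL m \<eta> \<alpha> P_ABS \<sigma> (s (X x)) (abs_dist c h (X x)) \<partial>M)"
    by (rule arg_cong[where f = "integral\<^sup>L M"])
      (simp add: fun_eq_iff B_def v_def path_loss_def conditional_coverage_def interference_laplace_def algebra_simps)
  finally show ?thesis
    using split by (simp add: s_def)
qed

section \<open>Polar coordinates\<close>

text \<open>The change of variables takes place in \<open>real^2\<close>, iterated integration on a
  product; this lemma links the two. Both measures give a box the product of its side lengths, and
  boxes determine Lebesgue measure.\<close>

lemma lborel_vec2_eq_distr:
  "(lborel :: (real^2) measure) = distr (lborel \<Otimes>\<^sub>M lborel) borel (\<lambda>p. vector [fst p, snd p])"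
proof (rule lborel_eqI)
  let ?V = "\<lambda>p::real \<times> real. vector [fst p, snd p] :: real^2"
  have [measurable]: "?V \<in> borel_measurable borel"
  proof -
    have "continuous_on UNIV ?V"
      by (subst continuous_on_componentwise)
        (auto simp: Basis_vec_def inner_axis forall_2 UNIV_2 intro!: continuous_intros)
    then show ?thesis by (rule borel_measurable_continuous_onI)
  qed
  then have V: "?V \<in> measurable (lborel \<Otimes>\<^sub>M lborel) borel"
    by (simp add: lborel_prod)
  show "sets (distr (lborel \<Otimes>\<^sub>M lborel) borel ?V) = sets borel" by simp
  fix l u :: "real^2"
  assume le: "\<And>b. b \<in> Basis \<Longrightarrow> l \<bullet> b \<le> u \<bullet> b"
  have le': "l$1 \<le> u$1" "l$2 \<le> u$2"
    using le[of "axis 1 1"] le[of "axis 2 1"] by (auto simp: Basis_vec_def inner_axis)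
  have "?V -` box l u \<inter> space (lborel \<Otimes>\<^sub>M lborel) = {l$1<..<u$1} \<times> {l$2<..<u$2}"
    by (auto simp: mem_box_cart forall_2 space_pair_measure)
  then have "emeasure (distr (lborel \<Otimes>\<^sub>M lborel) borel ?V) (box l u) =
      emeasure (lborel \<Otimes>\<^sub>M lborel) ({l$1<..<u$1} \<times> {l$2<..<u$2})"
    using V by (simp add: emeasure_distr)
  also have "\<dots> = ennreal (u$1 - l$1) * ennreal (u$2 - l$2)"
    using le' by (simp add: lborel.emeasure_pair_measure_Times)
  also have "\<dots> = (\<Prod>b\<in>Basis. (u - l) \<bullet> b)"
    using le' by (simp add: Basis_vec_def UNIV_2 inner_axis axis_eq_axis ennreal_mult mult.commute)
  finally show "emeasure (distr (lborel \<Otimes>\<^sub>M lborel) borel ?V) (box l u) = (\<Prod>b\<in>Basis. (u - l) \<bullet> b)" .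
qed


text \<open>
  Polar coordinates around \<open>c\<close> with polar axis in direction \<open>\<theta>\<close>, the radius being expressed through
  the distance \<open>z\<close> to the point at height \<open>h\<close> above \<open>c\<close>.
\<close>
definition polar_chart :: "real^2 \<Rightarrow> real \<Rightarrow> real \<Rightarrow> real \<Rightarrow> real \<Rightarrow> real^2" where
  "polar_chart c \<theta> h z \<omega> = c + sqrt (z\<^sup>2 - h\<^sup>2) *\<^sub>R vector [cos (\<theta> + \<omega>), sin (\<theta> + \<omega>)]"

text \<open>In this form the rules for continuity, measurability and derivatives apply, the axes
  being constant vectors.\<close>

lemma vector_2_eq_axis: "(vector [a, b] :: real^2) = a *\<^sub>R axis 1 1 + b *\<^sub>R axis 2 1"
  by (simp add: vec_eq_iff forall_2 axis_def)

text \<open>With \<open>r = sqrt (z\<^sup>2 - h\<^sup>2)\<close> the radial part contributes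
  \<open>z / r\<close> by the chain rule and the angle contributes the tangent vector scaled by
  \<open>r\<close>. The strict inequality keeps the root away from 0.\<close>

lemma polar_chart_has_derivative:
  assumes "h \<ge> 0" "h < v$1"
  shows "((\<lambda>v::real^2. polar_chart c \<theta> h (v$1) (v$2)) has_derivative
    (\<lambda>w. (w$1 * (v$1 / sqrt ((v$1)\<^sup>2 - h\<^sup>2))) *\<^sub>R vector [cos (\<theta> + v$2), sin (\<theta> + v$2)]
       + (w$2 * sqrt ((v$1)\<^sup>2 - h\<^sup>2)) *\<^sub>R vector [- sin (\<theta> + v$2), cos (\<theta> + v$2)])) (at v within S)"
proof -
  have pos: "(v$1)\<^sup>2 - h\<^sup>2 > 0"
    using assms by (simp add: power_strict_mono)
  have nth: "((\<lambda>v::real^2. v$i) has_derivative (\<lambda>w. w$i)) (at v within S)" for i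
    by (rule bounded_linear.has_derivative[OF bounded_linear_vec_nth has_derivative_ident])
  have comp: "((\<lambda>v::real^2. f (v$i)) has_derivative (\<lambda>w. w$i * f')) (at v within S)"
    if "(f has_real_derivative f') (at (v$i))" for f f' i
    using has_derivative_compose[OF nth that[unfolded has_field_derivative_def]]
    by (simp add: mult.commute)
  have r: "((\<lambda>v::real^2. sqrt ((v$1)\<^sup>2 - h\<^sup>2)) has_derivative
      (\<lambda>w. w$1 * (v$1 / sqrt ((v$1)\<^sup>2 - h\<^sup>2)))) (at v within S)"
    by (rule comp) (use pos in \<open>auto intro!: derivative_eq_intros simp: field_simps\<close>)
  have c: "((\<lambda>v::real^2. cos (\<theta> + v$2)) has_derivative (\<lambda>w. w$2 * (- sin (\<theta> + v$2)))) (at v within S)"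
    by (rule comp) (auto intro!: derivative_eq_intros)
  have s: "((\<lambda>v::real^2. sin (\<theta> + v$2)) has_derivative (\<lambda>w. w$2 * cos (\<theta> + v$2))) (at v within S)"
    by (rule comp) (auto intro!: derivative_eq_intros)
  show ?thesis
    unfolding polar_chart_def vector_2_eq_axis
    by (rule has_derivative_eq_rhs[OF has_derivative_add[OF has_derivative_const
        has_derivative_scaleR[OF r has_derivative_add[OF
          has_derivative_scaleR[OF c has_derivative_const]
          has_derivative_scaleR[OF s has_derivative_const]]]]])
      (simp add: fun_eq_iff vec_eq_iff forall_2 axis_def)
qed

text \<open>The columns are orthogonal, of lengths \<open>z / r\<close> and \<open>r\<close> for the
  radius \<open>r\<close>, so the radius cancels from the Jacobian.\<close>

lemma det_polar_chart:
  assumes "h \<ge> 0" "h < z"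
  shows "det (matrix (\<lambda>w::real^2. (w$1 * (z / sqrt (z\<^sup>2 - h\<^sup>2))) *\<^sub>R vector [cos t, sin t]
       + (w$2 * sqrt (z\<^sup>2 - h\<^sup>2)) *\<^sub>R vector [- sin t, cos t]) :: real^2^2) = z"
proof -
  have pos: "z\<^sup>2 - h\<^sup>2 > 0"
    using assms by (simp add: power_strict_mono)
  have "z * (cos t)\<^sup>2 + z * (sin t)\<^sup>2 = z"
    by (simp flip: distrib_left)
  with pos show ?thesis
    by (simp add: det_2 matrix_def axis_def power2_eq_square mult.left_commute)
qed

section \<open>Injectivity and range of the polar chart\<close>

lemma sin_cos_inj_window:
  assumes "cos s = cos t" "sin s = sin t" "\<bar>s - t\<bar> < 2 * pi"
  shows "s = t"
proof -
  obtain n :: int where "s = t + 2 * pi * n"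
    using assms sin_cos_eq_iff by metis
  with assms(3) show ?thesis by (auto simp: abs_mult)
qed

text \<open>The distance from \<open>c\<close> determines the radius and, as both heights exceed
  \<open>h \<ge> 0\<close>, also \<open>z\<close>. After cancelling the positive radius, cosine and
  sine agree, and an open window of one period rules out a shift by a full turn.\<close>

lemma polar_chart_inj:
  assumes "h \<ge> 0"
  shows "inj_on (\<lambda>v::real^2. polar_chart c \<theta> h (v$1) (v$2)) {v. h < v$1 \<and> a < v$2 \<and> v$2 < a + 2 * pi}"
proof (rule inj_onI, clarify)
  fix v w :: "real^2"
  assume v: "h < v$1" "a < v$2" "v$2 < a + 2 * pi" and w: "h < w$1" "a < w$2" "w$2 < a + 2 * pi"
    and eq: "polar_chart c \<theta> h (v$1) (v$2) = polar_chart c \<theta> h (w$1) (w$2)"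
  define r s where "r = sqrt ((v$1)\<^sup>2 - h\<^sup>2)" and "s = sqrt ((w$1)\<^sup>2 - h\<^sup>2)"
  have "r > 0" "s > 0"
    using v w assms by (simp_all add: r_def s_def power_strict_mono)
  have e: "r * cos (\<theta> + v$2) = s * cos (\<theta> + w$2)" "r * sin (\<theta> + v$2) = s * sin (\<theta> + w$2)"
    using eq by (simp_all add: polar_chart_def vec_eq_iff forall_2 r_def s_def)
  have sq: "x\<^sup>2 = (x * cos t)\<^sup>2 + (x * sin t)\<^sup>2" for x t :: real
    by (simp add: power_mult_distrib sin_squared_eq algebra_simps)
  have "r\<^sup>2 = s\<^sup>2"
    by (metis sq e)
  then have "r = s"
    using \<open>r > 0\<close> \<open>s > 0\<close> by (simp add: power2_eq_iff_nonneg)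
  then have "v$1 = w$1"
    using v w assms by (simp add: r_def s_def)
  moreover have "\<theta> + v$2 = \<theta> + w$2"
  proof (rule sin_cos_inj_window)
    show "cos (\<theta> + v$2) = cos (\<theta> + w$2)" "sin (\<theta> + v$2) = sin (\<theta> + w$2)"
      using e \<open>r = s\<close> \<open>s > 0\<close> by simp_all
    show "\<bar>\<theta> + v$2 - (\<theta> + w$2)\<bar> < 2 * pi"
      using v w by linarith
  qed
  ultimately show "v = w" by (simp add: vec_eq_iff forall_2)
qed

lemma exists_angle_in_window:
  obtains n :: int where "a \<le> t + 2 * pi * n" "t + 2 * pi * n < a + 2 * pi"
proof
  define n where "n = \<lceil>(a - t) / (2 * pi)\<rceil>"
  have "(a - t) / (2 * pi) \<le> n" "n < (a - t) / (2 * pi) + 1"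
    unfolding n_def by linarith+
  then show "a \<le> t + 2 * pi * n" "t + 2 * pi * n < a + 2 * pi"
    by (simp_all add: field_simps)
qed

lemma vec2_polar_form:
  fixes y :: "real^2"
  obtains t where "y = norm y *\<^sub>R vector [cos t, sin t]"
proof (cases "y = 0")
  case False
  define r where "r = norm y"
  have r: "r > 0" using False by (simp add: r_def)
  have "(y$1 / r)\<^sup>2 + (y$2 / r)\<^sup>2 = 1"
    using r by (simp add: r_def norm_vec_def L2_set_def sum_2 power_divide sum_power2_gt_zero_iff
        flip: add_divide_distrib)
  then obtain t where "y$1 / r = cos t" "y$2 / r = sin t"
    using sincos_total_2pi by metis
  from this[symmetric] r have "y = r *\<^sub>R vector [cos t, sin t]"
    by (simp add: vec_eq_iff forall_2)
  then show thesis using that by (simp add: r_def)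
qed (use that in simp)

text \<open>The open angular window misses \<open>c\<close> and one ray from it. The whole line
  through \<open>c\<close> with normal \<open>?n\<close> is discarded instead, being a negligible
  hyperplane; any point off it has an angle strictly inside the window.\<close>

lemma polar_chart_image:
  assumes "h \<ge> 0"
  shows "negligible (- (\<lambda>v::real^2. polar_chart c \<theta> h (v$1) (v$2)) ` {v. h < v$1 \<and> a < v$2 \<and> v$2 < a + 2 * pi})"
proof -
  let ?n = "vector [- sin (\<theta> + a), cos (\<theta> + a)] :: real^2"
  have n: "?n \<bullet> x = x$2 * cos (\<theta> + a) - x$1 * sin (\<theta> + a)" for x
    by (simp add: inner_vec_def sum_2)
  have "?n \<noteq> 0"
    using sin_zero_abs_cos_one[of "\<theta> + a"] by (auto simp: vec_eq_iff forall_2)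
  then have "negligible {x. ?n \<bullet> x = ?n \<bullet> c}"
    by (intro negligible_hyperplane) auto
  moreover have "x \<in> (\<lambda>v::real^2. polar_chart c \<theta> h (v$1) (v$2)) ` {v. h < v$1 \<and> a < v$2 \<and> v$2 < a + 2 * pi}"
    if x: "?n \<bullet> x \<noteq> ?n \<bullet> c" for x
  proof -
    define y where "y = x - c"
    define r where "r = norm y"
    have "y \<noteq> 0" using x by (auto simp: y_def)
    then have r: "r > 0" by (simp add: r_def)
    obtain t where t: "y = r *\<^sub>R vector [cos t, sin t]"
      unfolding r_def by (rule vec2_polar_form)
    obtain k :: int where k: "a \<le> (t - \<theta>) + 2 * pi * k" "(t - \<theta>) + 2 * pi * k < a + 2 * pi"
      by (rule exists_angle_in_window)
    define \<omega> where "\<omega> = (t - \<theta>) + 2 * pi * k"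
    have "\<theta> + \<omega> = t + 2 * pi * k" by (simp add: \<omega>_def)
    then have trig: "cos (\<theta> + \<omega>) = cos t" "sin (\<theta> + \<omega>) = sin t"
      by (simp_all add: cos_add sin_add)
    have y: "y$1 = r * cos (\<theta> + \<omega>)" "y$2 = r * sin (\<theta> + \<omega>)"
      unfolding trig t by simp_all
    have "\<omega> \<noteq> a"
    proof
      assume "\<omega> = a"
      then have "?n \<bullet> y = 0" by (simp add: n y)
      then show False using x by (simp add: y_def inner_diff_right)
    qed
    then have w: "a < \<omega>" "\<omega> < a + 2 * pi" using k by (auto simp: \<omega>_def)
    define z where "z = sqrt (r\<^sup>2 + h\<^sup>2)"
    have "h < z" unfolding z_def using r assms by (intro real_less_rsqrt) auto
    have "sqrt (z\<^sup>2 - h\<^sup>2) = r" using r by (simp add: z_def)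
    then have "x = polar_chart c \<theta> h z \<omega>"
      using y by (auto simp: polar_chart_def vec_eq_iff forall_2 y_def algebra_simps)
    with \<open>h < z\<close> w show ?thesis
      by (intro image_eqI[where x = "vector [z, \<omega>] :: real^2"]) auto
  qed
  ultimately show ?thesis
    by (elim negligible_subset) blast
qed


text \<open>The start \<open>a\<close> of the window stays free because the full circles are
  integrated over a window from 0 and the arcs, symmetric about the polar axis, over one from
  \<open>- pi\<close>.\<close>

theorem integral_polar_chart:
  fixes f :: "real^2 \<Rightarrow> real"
  assumes f: "integrable lborel f" and h: "h \<ge> 0"
  shows "(\<integral>x. f x \<partial>lborel) =
    (\<integral>z. (\<integral>\<omega>. indicator {h<..} z * indicator {a<..<a + 2 * pi} \<omega> * z * f (polar_chart c \<theta> h z \<omega>) \<partial>lborel) \<partial>lborel)"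
proof -
  define g where "g = (\<lambda>v::real^2. polar_chart c \<theta> h (v$1) (v$2))"
  define g' where "g' = (\<lambda>(v::real^2) (w::real^2). (w$1 * (v$1 / sqrt ((v$1)\<^sup>2 - h\<^sup>2))) *\<^sub>R vector [cos (\<theta> + v$2), sin (\<theta> + v$2)]
       + (w$2 * sqrt ((v$1)\<^sup>2 - h\<^sup>2)) *\<^sub>R vector [- sin (\<theta> + v$2), cos (\<theta> + v$2)] :: real^2)"
  define S where "S = {v::real^2. h < v$1 \<and> a < v$2 \<and> v$2 < a + 2 * pi}"
  define F where "F = (\<lambda>v::real^2. indicator S v * (v$1 * f (g v)))"
  have "open S"
    unfolding S_def by (intro open_Collect_conj open_Collect_less continuous_intros)
  then have S [measurable]: "S \<in> sets borel" by simp
  have [measurable]: "f \<in> borel_measurable borel"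
    using f by auto
  have cont: "continuous_on UNIV g"
    unfolding g_def polar_chart_def vector_2_eq_axis by (intro continuous_intros)
  then have [measurable]: "g \<in> borel_measurable borel"
    by (rule borel_measurable_continuous_onI)
  have [measurable]: "F \<in> borel_measurable borel"
    unfolding F_def by measurable
  have "f absolutely_integrable_on UNIV"
    using f by (simp add: set_integrable_def integrable_completion)
  moreover have int: "integral UNIV f = (\<integral>x. f x \<partial>lborel)"
    using f by (simp add: integral_lebesgue integrable_completion integral_completion)
  \<comment> \<open>The missed set is negligible, so the integral over the plane equals the integral
    over the image of \<open>S\<close>.\<close>
  moreover have neg: "negligible (- g ` S)"
    unfolding g_def S_def by (rule polar_chart_image[OF h])
  moreover have "negligible {x \<in> UNIV - g ` S. f x \<noteq> 0}" "negligible {x \<in> g ` S - UNIV. f x \<noteq> 0}"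
    by (auto intro: negligible_subset[OF neg])
  ultimately have "f absolutely_integrable_on g ` S" and "integral (g ` S) f = (\<integral>x. f x \<partial>lborel)"
    using absolutely_integrable_spike_set_eq[of UNIV "g ` S" f] integral_spike_set[of UNIV "g ` S" f] by auto
  \<comment> \<open>The change of variables theorem concerns functions with values in some
    \<open>real^n\<close>, so the scalar \<open>f\<close> is wrapped into \<open>real^1\<close> and
    unwrapped afterwards.\<close>
  then have "(\<lambda>x. vec (f x) :: real^1) absolutely_integrable_on g ` S"
    "integral (g ` S) (\<lambda>x. vec (f x) :: real^1) = vec (\<integral>x. f x \<partial>lborel)"
    by (simp_all add: absolutely_integrable_on_1_iff integral_on_1_eq)
  moreover have "S \<in> sets lebesgue" using S by simp
  moreover have "\<And>v. v \<in> S \<Longrightarrow> (g has_derivative g' v) (at v within S)"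
    unfolding g_def g'_def S_def using h by (intro polar_chart_has_derivative) auto
  moreover have "inj_on g S"
    unfolding g_def S_def by (rule polar_chart_inj[OF h])
  ultimately have *: "(\<lambda>v. \<bar>det (matrix (g' v))\<bar> *\<^sub>R (vec (f (g v)) :: real^1)) absolutely_integrable_on S"
    "integral S (\<lambda>v. \<bar>det (matrix (g' v))\<bar> *\<^sub>R (vec (f (g v)) :: real^1)) = vec (\<integral>x. f x \<partial>lborel)"
    using has_absolute_integral_change_of_variables[of S g g' "\<lambda>x. vec (f x)" "vec (\<integral>x. f x \<partial>lborel)"]
    by blast+
  have **: "(\<lambda>v. \<bar>det (matrix (g' v))\<bar> * f (g v)) absolutely_integrable_on S"
    "integral S (\<lambda>v. \<bar>det (matrix (g' v))\<bar> * f (g v)) = (\<integral>x. f x \<partial>lborel)"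
    using * by (simp_all add: absolutely_integrable_on_1_iff integral_on_1_eq vec_eq_iff)
  have det: "\<bar>det (matrix (g' v))\<bar> * f (g v) = v$1 * f (g v)" if "v \<in> S" for v
    using that h unfolding g'_def S_def by (subst det_polar_chart) auto
  have "set_integrable lebesgue S (\<lambda>v. v$1 * f (g v))"
    by (rule set_integrable_cong[THEN iffD1, OF refl refl det **(1)])
  moreover have "integral S (\<lambda>v. v$1 * f (g v)) = (\<integral>x. f x \<partial>lborel)"
    by (rule trans[OF sym[OF integral_cong[OF det]] **(2)])
  ultimately have "integrable lebesgue F" and "(\<integral>v. F v \<partial>lebesgue) = (\<integral>x. f x \<partial>lborel)"
    using set_lebesgue_integral_eq_integral(2)[of S "\<lambda>v. v$1 * f (g v)"]
    by (simp_all add: set_integrable_def set_lebesgue_integral_def F_def)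
  then have F: "integrable lborel F" "(\<integral>v. F v \<partial>lborel) = (\<integral>x. f x \<partial>lborel)"
    by (simp_all add: integrable_completion integral_completion)
  have V: "(\<lambda>p. vector [fst p, snd p] :: real^2) \<in> measurable (lborel \<Otimes>\<^sub>M lborel) borel"
    unfolding vector_2_eq_axis by measurable
  have "integrable (lborel \<Otimes>\<^sub>M lborel) (\<lambda>p. F (vector [fst p, snd p]))"
    using F(1) V by (subst (asm) lborel_vec2_eq_distr) (simp add: integrable_distr_eq)
  moreover have "(\<integral>p. F (vector [fst p, snd p]) \<partial>(lborel \<Otimes>\<^sub>M lborel)) = (\<integral>x. f x \<partial>lborel)"
    using F(2)[symmetric] V by (subst (asm) lborel_vec2_eq_distr) (simp add: integral_distr)
  ultimately have "(\<integral>z. (\<integral>\<omega>. F (vector [z, \<omega>]) \<partial>lborel) \<partial>lborel) = (\<integral>x. f x \<partial>lborel)"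
    using lborel_pair.integral_fst'[of "\<lambda>p. F (vector [fst p, snd p])"] by simp
  moreover have "F (vector [z, \<omega>]) =
      indicator {h<..} z * indicator {a<..<a + 2 * pi} \<omega> * z * f (polar_chart c \<theta> h z \<omega>)" for z \<omega>
    by (simp add: F_def S_def g_def indicator_def)
  ultimately show ?thesis by (simp only:)
qed

section \<open>Distances in the polar chart and the arc inside the cell\<close>

lemma dist_polar_chart:
  assumes "0 \<le> h" "h \<le> z"
  shows "dist (polar_chart c \<theta> h z \<omega>) c = sqrt (z\<^sup>2 - h\<^sup>2)"
proof -
  have "norm (vector [cos t, sin t] :: real^2) = 1" for t
    by (simp add: norm_vec_def L2_set_def sum_2)
  moreover have "z\<^sup>2 - h\<^sup>2 \<ge> 0" using assms by (simp add: power_mono)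
  ultimately show ?thesis by (simp add: polar_chart_def dist_norm)
qed

lemma abs_dist_eq: "abs_dist c h x = sqrt ((dist x c)\<^sup>2 + h\<^sup>2)"
  by (simp add: abs_dist_def dist_Pair_Pair)

lemma abs_dist_polar_chart:
  assumes "0 \<le> h" "h \<le> z"
  shows "abs_dist c h (polar_chart c \<theta> h z \<omega>) = z"
proof -
  have "z\<^sup>2 - h\<^sup>2 \<ge> 0" using assms by (simp add: power_mono)
  then show ?thesis
    using assms by (simp add: abs_dist_eq dist_polar_chart[OF assms])
qed

text \<open>As \<theta> is the direction from \<open>c\<close> to the second point, \<omega> is the
  angle at \<open>c\<close> of the triangle; the addition theorem for \<open>cos (p - q)\<close>
  makes \<theta> drop out.\<close>

lemma dist_polar_chart_law_of_cosines:
  assumes "0 \<le> h" "h \<le> z"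
  shows "(dist (polar_chart c \<theta> h z \<omega>) (c + d *\<^sub>R vector [cos \<theta>, sin \<theta>]))\<^sup>2 =
    z\<^sup>2 - h\<^sup>2 + d\<^sup>2 - 2 * sqrt (z\<^sup>2 - h\<^sup>2) * d * cos \<omega>"
proof -
  define r where "r = sqrt (z\<^sup>2 - h\<^sup>2)"
  have r2: "r\<^sup>2 = z\<^sup>2 - h\<^sup>2" using assms by (simp add: r_def power_mono)
  define p q where "p = \<theta> + \<omega>" and "q = \<theta>"
  have "cos \<omega> = cos (p - q)" by (simp add: p_def q_def)
  then have c: "cos \<omega> = cos p * cos q + sin p * sin q" by (simp add: cos_diff)
  have "(dist (polar_chart c \<theta> h z \<omega>) (c + d *\<^sub>R vector [cos \<theta>, sin \<theta>]))\<^sup>2 =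
      (r * cos p - d * cos q)\<^sup>2 + (r * sin p - d * sin q)\<^sup>2"
    by (simp add: polar_chart_def dist_vec_def L2_set_def sum_2 dist_real_def p_def q_def r_def)
  also have "\<dots> = r\<^sup>2 * ((cos p)\<^sup>2 + (sin p)\<^sup>2) + d\<^sup>2 * ((cos q)\<^sup>2 + (sin q)\<^sup>2) - 2 * r * d * cos \<omega>"
    unfolding c by (simp only: power2_eq_square algebra_simps)
  finally show ?thesis by (simp add: r2 r_def[symmetric])
qed

lemma sqrt_less_hypotenuse_iff:
  assumes "0 \<le> h" "h < z" "0 \<le> a"
  shows "sqrt (a\<^sup>2 + h\<^sup>2) < z \<longleftrightarrow> a < sqrt (z\<^sup>2 - h\<^sup>2)"
proof -
  have "sqrt (a\<^sup>2 + h\<^sup>2) < sqrt (z\<^sup>2) \<longleftrightarrow> sqrt (a\<^sup>2) < sqrt (z\<^sup>2 - h\<^sup>2)"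
    unfolding real_sqrt_less_iff by linarith
  then show ?thesis using assms by simp
qed

lemma le_hypotenuse_iff:
  assumes "0 \<le> h" "h < z" "0 \<le> a"
  shows "z \<le> sqrt (a\<^sup>2 + h\<^sup>2) \<longleftrightarrow> sqrt (z\<^sup>2 - h\<^sup>2) \<le> a"
  using sqrt_less_hypotenuse_iff[OF assms] by linarith

text \<open>By the law of cosines, \<open>x\<close> is the cosine of the angle at which the circle
  of radius \<open>r\<close> around \<open>c\<close> crosses the boundary of the cell. Triangle
  inequalities between \<open>r\<close>, \<open>d\<close> and \<open>R1\<close> place
  \<open>x\<close> above -1 and at most at 1; as \<open>cos\<close> decreases on
  \<open>[0, pi]\<close>, lying in the cell is a bound on \<bar>\<omega>\<bar>.\<close>

lemma omega_hat_bounds: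
  fixes d h z R1 :: real
  assumes "0 \<le> h" "h < z" "0 < d" "d < R1"
    and lo: "R1 - d < sqrt (z\<^sup>2 - h\<^sup>2)" and hi: "sqrt (z\<^sup>2 - h\<^sup>2) \<le> R1 + d"
  shows "0 \<le> omega_hat R1 d h z" "omega_hat R1 d h z < pi"
    and "\<bar>\<omega>\<bar> \<le> pi \<Longrightarrow>
      z\<^sup>2 - h\<^sup>2 + d\<^sup>2 - 2 * sqrt (z\<^sup>2 - h\<^sup>2) * d * cos \<omega> \<le> R1\<^sup>2 \<longleftrightarrow> \<bar>\<omega>\<bar> \<le> omega_hat R1 d h z"
proof -
  define r where "r = sqrt (z\<^sup>2 - h\<^sup>2)"
  define x where "x = (d\<^sup>2 + r\<^sup>2 - R1\<^sup>2) / (2 * d * r)"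
  have r2: "r\<^sup>2 = z\<^sup>2 - h\<^sup>2" using assms by (simp add: r_def power_mono)
  have r: "r > 0" using assms by (simp add: r_def power_strict_mono)
  \<comment> \<open>Inverting the quotient also covers
    \<open>d\<^sup>2 + r\<^sup>2 = R1\<^sup>2\<close>: division by zero then gives
    \<open>arccos 0\<close>, in agreement with \<open>x = 0\<close>.\<close>
  have \<omega>: "omega_hat R1 d h z = arccos x"
    by (simp add: omega_hat_def arcsec_def x_def r2 r_def[symmetric] add_diff_eq)
  have "R1\<^sup>2 < (r + d)\<^sup>2"
    using assms lo by (intro power_strict_mono) (auto simp: r_def)
  then have x1: "-1 < x"
    using r assms by (simp add: x_def less_divide_eq power2_sum algebra_simps)
  \<comment> \<open>Equality occurs at \<open>r = R1 + d\<close>, where the circle meets the cell in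
    one point and the half-angle is 0.\<close>
  have "(r - d)\<^sup>2 \<le> R1\<^sup>2"
    using assms r hi by (intro abs_le_square_iff[THEN iffD1]) (auto simp: r_def)
  then have x2: "x \<le> 1"
    using r assms by (simp add: x_def divide_le_eq power2_diff algebra_simps)
  show "0 \<le> omega_hat R1 d h z"
    using x1 x2 by (simp add: \<omega> arccos_lbound)
  show "omega_hat R1 d h z < pi"
    using arccos_less_arccos[of "-1" x] x1 x2 by (simp add: \<omega>)
  assume "\<bar>\<omega>\<bar> \<le> pi"
  have "z\<^sup>2 - h\<^sup>2 + d\<^sup>2 - 2 * sqrt (z\<^sup>2 - h\<^sup>2) * d * cos \<omega> \<le> R1\<^sup>2 \<longleftrightarrow> x \<le> cos \<bar>\<omega>\<bar>"
    using r assms by (simp add: x_def divide_le_eq r2[symmetric] r_def[symmetric] algebra_simps)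
  also have "\<dots> \<longleftrightarrow> cos (arccos x) \<le> cos \<bar>\<omega>\<bar>"
    using x1 x2 by (simp add: cos_arccos)
  also have "\<dots> \<longleftrightarrow> \<bar>\<omega>\<bar> \<le> arccos x"
    using x1 x2 \<open>\<bar>\<omega>\<bar> \<le> pi\<close> by (intro cos_mono_le_eq) (auto simp: arccos_lbound arccos_ubound)
  finally show "z\<^sup>2 - h\<^sup>2 + d\<^sup>2 - 2 * sqrt (z\<^sup>2 - h\<^sup>2) * d * cos \<omega> \<le> R1\<^sup>2 \<longleftrightarrow> \<bar>\<omega>\<bar> \<le> omega_hat R1 d h z"
    by (simp add: \<omega>)
qed

section \<open>The uniform distribution on the cell minus the stadium\<close>

text \<open>Finite nonzero mass allows the normalised indicator to be rewritten as a real density,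
  to which the rule for Bochner integrals applies.\<close>

lemma integral_uniform_measure_real:
  fixes f :: "'a \<Rightarrow> real"
  assumes [measurable]: "A \<in> sets M" "f \<in> borel_measurable M" and "emeasure M A \<noteq> 0" "emeasure M A \<noteq> \<infinity>"
  shows "(\<integral>x. f x \<partial>uniform_measure M A) = (\<integral>x. indicator A x * f x \<partial>M) / measure M A"
proof -
  have e: "emeasure M A = ennreal (measure M A)"
    using assms(4) by (intro emeasure_eq_ennreal_measure) simp
  with assms(3) have "measure M A \<noteq> 0"
    by (metis ennreal_0)
  then have m: "measure M A > 0"
    by (simp add: zero_less_measure_iff)
  have "uniform_measure M A = density M (\<lambda>x. ennreal (indicator A x / measure M A))"
    unfolding uniform_measure_def e using m
    by (intro arg_cong[where f = "density M"]) (auto simp: fun_eq_iff indicator_def simp flip: divide_ennreal)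
  then have "(\<integral>x. f x \<partial>uniform_measure M A) = (\<integral>x. indicator A x / measure M A * f x \<partial>M)"
    by (simp add: integral_density)
  also have "\<dots> = (\<integral>x. indicator A x * f x / measure M A \<partial>M)"
    by (simp add: mult.commute)
  finally show ?thesis by simp
qed

lemma measure_disk_minus_disk:
  fixes a b :: "real^2"
  assumes "0 \<le> R2" "cball b R2 \<subseteq> cball a R1" "0 \<le> R1"
  shows "measure lborel (cball a R1 - cball b R2) = pi * (R1\<^sup>2 - R2\<^sup>2)"
proof -
  have "measure lborel (cball x r :: (real^2) set) = pi * r\<^sup>2" if "r \<ge> 0" for x r
    using that by (simp add: content_cball_conv_ball circle_area mult.commute)
  moreover have "emeasure lborel (cball a R1) \<noteq> \<infinity>"
    using emeasure_lborel_cball_finite[of a R1] by (simp add: less_top)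
  ultimately show ?thesis
    using assms by (subst measure_Diff) (simp_all add: right_diff_distrib)
qed

theorem theorem3:
  fixes M :: "'a measure"
    and X :: "'a \<Rightarrow> real^2" and K :: "'a \<Rightarrow> link_state" and G H :: "'a \<Rightarrow> real"
    and tbs c :: "real^2" and R1 R2 d h :: real
    and pL :: "real \<Rightarrow> real" and \<eta> \<alpha> m :: "link_state \<Rightarrow> real"
    and \<alpha>T P_TBS P_ABS \<sigma> \<gamma> :: real
  assumes "prob_space M"
    and "R2 > 0" and "d > 0" and "h > 0" and "d + R2 \<le> R1" and "dist tbs c = d"
    and "X \<in> borel_measurable M"
    and "distr M lborel X = uniform_measure lborel (cball tbs R1 - cball c R2)"
    and "pL \<in> borel_measurable borel" and "\<And>z. 0 \<le> pL z \<and> pL z \<le> 1"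
    and "\<And>k. \<eta> k > 0" and "\<And>k. \<alpha> k > 0" and "\<eta> LOS > \<eta> NLOS" and "\<And>k. m k > 0"
    and "\<alpha>T > 0" and "P_TBS > 0" and "P_ABS > 0" and "\<sigma> > 0" and "\<gamma> > 0"
    and "K \<in> measurable M (count_space UNIV)"
    and "AE x in M. real_cond_exp M (vimage_algebra (space M) X borel)
           (indicat_real {x \<in> space M. K x = LOS}) x = pL (abs_dist c h (X x))"
    and "G \<in> borel_measurable M"
    and "\<And>k. measure M {x \<in> space M. K x = k} > 0 \<Longrightarrow>
           distributed (uniform_measure M {x \<in> space M. K x = k}) lborel G
             (gamma_density (m k) (m k))"
    and "\<And>k. measure M {x \<in> space M. K x = k} > 0 \<Longrightarrow>
           indep_rv (uniform_measure M {x \<in> space M. K x = k}) borel G borel X"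
    and "distributed M lborel H (exponential_density 1)"
    and "indep_rv M borel H
           (borel \<Otimes>\<^sub>M count_space UNIV \<Otimes>\<^sub>M borel) (\<lambda>x. (X x, K x, G x))"
  shows "measure M {x \<in> space M.
           SINR P_TBS P_ABS \<sigma> \<alpha>T (H x) (dist (X x) tbs) (G x)
             (path_loss \<eta> \<alpha> (K x) (abs_dist c h (X x))) > \<gamma>} =
         (LBINT z = sqrt (R2\<^sup>2 + h\<^sup>2)..sqrt ((R1 - d)\<^sup>2 + h\<^sup>2). (LBINT \<omega> = 0..2 * pi.
            interference_laplace pL m \<eta> \<alpha> P_ABS (laplace_arg \<gamma> P_TBS \<alpha>T d h z \<omega>) z *
            exp (- laplace_arg \<gamma> P_TBS \<alpha>T d h z \<omega> * \<sigma>\<^sup>2) *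
            f_Omega R1 R2 d h \<omega> z * f_Z R1 R2 d h z)) +
         (LBINT z = sqrt ((R1 - d)\<^sup>2 + h\<^sup>2)..sqrt ((R1 + d)\<^sup>2 + h\<^sup>2).
          (LBINT \<omega> = - omega_hat R1 d h z..omega_hat R1 d h z.
            interference_laplace pL m \<eta> \<alpha> P_ABS (laplace_arg \<gamma> P_TBS \<alpha>T d h z \<omega>) z *
            exp (- laplace_arg \<gamma> P_TBS \<alpha>T d h z \<omega> * \<sigma>\<^sup>2) *
            f_Omega R1 R2 d h \<omega> z * f_Z R1 R2 d h z))"
proof -
  note X = assms(7) and dX = assms(8) and pL = assms(9) and pL01 = assms(10)
  note pos = assms(2-4) assms(15-19)
  have m: "m k > 0" and \<eta>: "\<eta> k > 0" for k by (rule assms)+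
  \<comment> \<open>These are the distances to the ABS at ground radius \<open>R2\<close> (rim of
    the stadium), \<open>R1 - d\<close> (largest circle around \<open>c\<close> inside the cell) and
    \<open>R1 + d\<close> (farthest point of the cell).\<close>
  define z0 z1 z2 where "z0 = sqrt (R2\<^sup>2 + h\<^sup>2)" and "z1 = sqrt ((R1 - d)\<^sup>2 + h\<^sup>2)" and "z2 = sqrt ((R1 + d)\<^sup>2 + h\<^sup>2)"
  define n where "n = pi * (R1\<^sup>2 - R2\<^sup>2)"
  define \<Phi> where "\<Phi> = (\<lambda>x. conditional_coverage pL m \<eta> \<alpha> P_ABS \<sigma>
    (\<gamma> / P_TBS * dist x tbs powr \<alpha>T) (abs_dist c h x))"
  define C where "C = (\<lambda>z \<omega>. conditional_coverage pL m \<eta> \<alpha> P_ABS \<sigma> (laplace_arg \<gamma> P_TBS \<alpha>T d h z \<omega>) z)"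
  define w where "w = omega_hat R1 d h"
  \<comment> \<open>\<open>D1\<close> is a full annulus around \<open>c\<close>, and circles around
    \<open>c\<close> meet \<open>D2\<close> in arcs. Since closed disks are removed, the two
    partition the user region exactly.\<close>
  define D1 D2 where "D1 = cball c (R1 - d) - cball c R2" and "D2 = cball tbs R1 - cball c (R1 - d)"
  have "R1 > R2" and dR: "d < R1" and R2: "R2 \<le> R1 - d" using pos assms(5) by auto
  then have n: "n > 0" using pos by (simp add: n_def power_strict_mono)
  have z01: "z0 \<le> z1" and z12: "z1 \<le> z2" and z0: "h < z0"
    using R2 pos dR unfolding z0_def z1_def z2_def
    by (auto intro!: real_sqrt_le_mono power_mono real_less_rsqrt)
  have sub: "cball c (R1 - d) \<subseteq> cball tbs R1" "cball c R2 \<subseteq> cball c (R1 - d)"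
    using assms(6) R2 by (auto simp: cball_subset_cball_iff dist_commute)
  \<comment> \<open>The polar axis is pointed at the TBS, so that \<omega> becomes the angle in the
    law of cosines.\<close>
  obtain \<theta> where "tbs - c = norm (tbs - c) *\<^sub>R vector [cos \<theta>, sin \<theta>]"
    by (rule vec2_polar_form)
  then have tbs: "tbs = c + d *\<^sub>R vector [cos \<theta>, sin \<theta>]"
    using assms(6) by (simp add: dist_norm algebra_simps)

  have [measurable]: "pL \<in> borel_measurable borel" by (rule pL)
  have [measurable]: "abs_dist c h \<in> borel_measurable borel"
    unfolding abs_dist_eq[abs_def] by measurable
  have \<Phi>_meas [measurable]: "\<Phi> \<in> borel_measurable borel"
    unfolding \<Phi>_def conditional_coverage_def interference_laplace_def by measurable
  have \<Phi>_bnd: "\<bar>\<Phi> x\<bar> \<le> 1" for x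
    unfolding \<Phi>_def using pos by (intro conditional_coverage_bounds pL01 \<eta> m) auto
  have int: "integrable lborel (\<lambda>x. indicator D x * \<Phi> x)"
    if "D \<subseteq> cball tbs R1" and [measurable]: "D \<in> sets borel" for D
  proof (rule Bochner_Integration.integrable_bound)
    show "integrable lborel (\<lambda>x. indicator (cball tbs R1) x :: real)"
      using emeasure_lborel_cball_finite[of tbs R1] by (intro integrable_real_indicator) simp_all
    show "AE x in lborel. norm (indicator D x * \<Phi> x) \<le> norm (indicator (cball tbs R1) x :: real)"
      using that(1) \<Phi>_bnd by (intro AE_I2) (auto simp: indicator_def)
  qed measurable
  have D: "D1 \<subseteq> cball tbs R1" "D1 \<in> sets borel" "D2 \<subseteq> cball tbs R1" "D2 \<in> sets borel"
    using sub by (auto simp: D1_def D2_def)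

  define R where "R = cball tbs R1 - cball c R2"
  have R_meas [measurable]: "R \<in> sets borel" by (simp add: R_def)
  have mR: "measure lborel R = n"
    unfolding R_def n_def using sub pos dR by (intro measure_disk_minus_disk) auto
  then have eR: "emeasure lborel R \<noteq> 0" using n by (metis enn2real_0 less_irrefl measure_def)
  have "emeasure lborel R \<le> emeasure lborel (cball tbs R1)"
    by (intro emeasure_mono) (auto simp: R_def)
  then have eR': "emeasure lborel R \<noteq> \<infinity>"
    using emeasure_lborel_cball_finite[of tbs R1] by (auto simp: less_top top_unique)
  \<comment> \<open>A single point is null under the uniform law; at the TBS itself the SINR formula
    degenerates.\<close>
  have nontbs: "AE x in M. X x \<noteq> tbs"
  proof -
    have "AE x in uniform_measure lborel R. x \<noteq> tbs"
      by (intro AE_uniform_measureI) (auto intro: AE_lborel_singleton eventually_mono)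
    then have "AE x in distr M lborel X. x \<noteq> tbs"
      unfolding dX R_def[symmetric] .
    then show ?thesis using X by (subst (asm) AE_distr_iff) auto
  qed
  have "measure M {x \<in> space M. SINR P_TBS P_ABS \<sigma> \<alpha>T (H x) (dist (X x) tbs) (G x)
             (path_loss \<eta> \<alpha> (K x) (abs_dist c h (X x))) > \<gamma>} = (\<integral>x. \<Phi> (X x) \<partial>M)"
    unfolding \<Phi>_def
    by (rule coverage_probability_eq_expectation[OF assms(1) X nontbs pL \<eta> m pos(5) pos(6) pos(7) pos(8)
        assms(20-26)])
  also have "\<dots> = (\<integral>x. \<Phi> x \<partial>distr M lborel X)"
    using X by (subst integral_distr) auto
  also have "\<dots> = (\<integral>x. indicator R x * \<Phi> x \<partial>lborel) / n"
    unfolding dX R_def[symmetric] mR[symmetric] by (rule integral_uniform_measure_real) (use eR eR' in auto)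
  also have "(\<integral>x. indicator R x * \<Phi> x \<partial>lborel) = (\<integral>x. indicator D1 x * \<Phi> x + indicator D2 x * \<Phi> x \<partial>lborel)"
    using sub by (intro Bochner_Integration.integral_cong) (auto simp: R_def D1_def D2_def indicator_def)
  also have "\<dots> = (\<integral>x. indicator D1 x * \<Phi> x \<partial>lborel) + (\<integral>x. indicator D2 x * \<Phi> x \<partial>lborel)"
    using int D by (intro Bochner_Integration.integral_add) auto
  finally have split: "measure M {x \<in> space M. SINR P_TBS P_ABS \<sigma> \<alpha>T (H x) (dist (X x) tbs) (G x)
             (path_loss \<eta> \<alpha> (K x) (abs_dist c h (X x))) > \<gamma>} =
      (\<integral>x. indicator D1 x * \<Phi> x \<partial>lborel) / n + (\<integral>x. indicator D2 x * \<Phi> x \<partial>lborel) / n"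
    by (simp add: add_divide_distrib)

  \<comment> \<open>The two regions seen in the polar chart\<close>
  let ?p = "polar_chart c \<theta> h"
  have \<Phi>_chart: "\<Phi> (?p z \<omega>) = C z \<omega>" if "h < z" for z \<omega>
  proof -
    define Q where "Q = z\<^sup>2 - h\<^sup>2 + d\<^sup>2 - 2 * sqrt (z\<^sup>2 - h\<^sup>2) * d * cos \<omega>"
    have Q: "(dist (?p z \<omega>) tbs)\<^sup>2 = Q"
      unfolding Q_def tbs using that pos by (intro dist_polar_chart_law_of_cosines) auto
    then have "Q \<ge> 0" by (metis zero_le_power2)
    \<comment> \<open>Writing the root as a power lets the exponents multiply to the
      \<open>\<alpha>T / 2\<close> of \<open>laplace_arg\<close>.\<close>
    have "dist (?p z \<omega>) tbs = Q powr (1 / 2)"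
      using Q \<open>Q \<ge> 0\<close> by (simp add: powr_half_sqrt flip: Q)
    then have "dist (?p z \<omega>) tbs powr \<alpha>T = Q powr (\<alpha>T / 2)"
      by (simp add: powr_powr)
    then show ?thesis
      using that pos by (simp add: \<Phi>_def C_def laplace_arg_def abs_dist_polar_chart Q_def)
  qed
  have D1_chart: "?p z \<omega> \<in> D1 \<longleftrightarrow> z0 < z \<and> z \<le> z1" if "h < z" for z \<omega>
    using sqrt_less_hypotenuse_iff[of h z R2] le_hypotenuse_iff[of h z "R1 - d"] that pos dR
    by (auto simp: D1_def dist_polar_chart z0_def z1_def dist_commute[of c])
  have D2_chart: "?p z \<omega> \<in> D2 \<longleftrightarrow> z1 < z \<and> z \<le> z2 \<and> \<bar>\<omega>\<bar> \<le> w z" if "h < z" "\<bar>\<omega>\<bar> \<le> pi" for z \<omega>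
  proof -
    have r: "dist (?p z \<omega>) c = sqrt (z\<^sup>2 - h\<^sup>2)"
      using that pos by (intro dist_polar_chart) auto
    have i1: "z1 < z \<longleftrightarrow> R1 - d < sqrt (z\<^sup>2 - h\<^sup>2)" and i2: "z \<le> z2 \<longleftrightarrow> sqrt (z\<^sup>2 - h\<^sup>2) \<le> R1 + d"
      using le_hypotenuse_iff[of h z "R1 + d"] sqrt_less_hypotenuse_iff[of h z "R1 - d"] that pos dR
      by (simp_all add: z1_def z2_def)
    \<comment> \<open>A point of the cell has radius at most \<open>R1 + d\<close>, so beyond
      \<open>z2\<close> no angle leads into \<open>D2\<close>.\<close>
    have tri: "dist (?p z \<omega>) c \<le> dist (?p z \<omega>) tbs + d"
      using dist_triangle[of "?p z \<omega>" c tbs] assms(6) by simp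
    have "dist (?p z \<omega>) tbs \<le> R1 \<longleftrightarrow> (dist (?p z \<omega>) tbs)\<^sup>2 \<le> R1\<^sup>2"
      using pos dR by (simp add: power_mono_iff)
    also have "\<dots> \<longleftrightarrow> z\<^sup>2 - h\<^sup>2 + d\<^sup>2 - 2 * sqrt (z\<^sup>2 - h\<^sup>2) * d * cos \<omega> \<le> R1\<^sup>2"
      unfolding tbs using that pos by (subst dist_polar_chart_law_of_cosines) auto
    finally have i3: "dist (?p z \<omega>) tbs \<le> R1 \<longleftrightarrow> \<bar>\<omega>\<bar> \<le> w z" if "z1 < z" "z \<le> z2"
      using omega_hat_bounds(3)[of h z d R1 \<omega>] that i1 i2 \<open>h < z\<close> \<open>\<bar>\<omega>\<bar> \<le> pi\<close> pos dR by (simp add: w_def)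
    show ?thesis
    proof (cases "z1 < z \<and> z \<le> z2")
      case True
      then show ?thesis using i1 i3 r by (simp add: D2_def dist_commute)
    next
      case False
      then show ?thesis using i1 i2 r tri by (auto simp: D2_def dist_commute)
    qed
  qed
  have f1: "f_Omega R1 R2 d h \<omega> z * f_Z R1 R2 d h z = z / n" if "z0 < z" "z \<le> z1" for z \<omega>
    using that by (simp add: f_Omega_def f_Z_def z0_def z1_def n_def)
  \<comment> \<open>The half-angle cancels between the two densities unless it is 0. In that case
    the product is 0 by division by zero, but the inner integral then runs from 0 to 0 and no value
    matters.\<close>
  have f2: "f_Omega R1 R2 d h \<omega> z * f_Z R1 R2 d h z = z / n" if "z1 < z" "z \<le> z2" "w z \<noteq> 0" for z \<omega>
    using that by (simp add: f_Omega_def f_Z_def z1_def z2_def n_def w_def)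
  \<comment> \<open>Endpoints are null, so each integral may use the interval matching its region:
    half-open for \<open>z\<close>, open for the full turn, closed for the arc.\<close>
  have Ioc: "(LBINT z=a..b. f z) = (\<integral>z. indicator {a<..b} z * f z \<partial>lborel)" if "a \<le> b" for a b :: real and f :: "real \<Rightarrow> real"
    using that by (simp add: interval_integral_Ioc set_lebesgue_integral_def)
  have Ioo: "(LBINT z=a..b. f z) = (\<integral>z. indicator {a<..<b} z * f z \<partial>lborel)" if "a \<le> b" for a b :: real and f :: "real \<Rightarrow> real"
    using that by (simp add: interval_integral_Ioo set_lebesgue_integral_def)
  have Icc: "(LBINT z=a..b. f z) = (\<integral>z. indicator {a..b} z * f z \<partial>lborel)" if "a \<le> b" for a b :: real and f :: "real \<Rightarrow> real"
    using that by (simp add: interval_integral_Icc set_lebesgue_integral_def)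

  \<comment> \<open>The window starts at \<open>a = 0\<close>; the unsimplified
    \<open>0 + 2 * pi\<close> keeps the shape of \<open>integral_polar_chart\<close>.\<close>
  have "(LBINT z=z0..z1. (LBINT \<omega>=0..2 * pi. C z \<omega> * f_Omega R1 R2 d h \<omega> z * f_Z R1 R2 d h z)) =
      (\<integral>z. (\<integral>\<omega>. indicator {h<..} z * indicator {0<..<0 + 2 * pi} \<omega> * z * (indicator D1 (?p z \<omega>) * \<Phi> (?p z \<omega>)) \<partial>lborel) / n \<partial>lborel)"
    unfolding Ioc[OF z01]
  proof (intro Bochner_Integration.integral_cong refl)
    fix z
    show "indicator {z0<..z1} z * (LBINT \<omega>=0..2 * pi. C z \<omega> * f_Omega R1 R2 d h \<omega> z * f_Z R1 R2 d h z) =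
      (\<integral>\<omega>. indicator {h<..} z * indicator {0<..<0 + 2 * pi} \<omega> * z * (indicator D1 (?p z \<omega>) * \<Phi> (?p z \<omega>)) \<partial>lborel) / n"
    proof (cases "z0 < z \<and> z \<le> z1")
      case True
      then have "h < z" using z0 by simp
      have "(LBINT \<omega>=0..2 * pi. C z \<omega> * f_Omega R1 R2 d h \<omega> z * f_Z R1 R2 d h z) =
          (LBINT \<omega>=ereal 0..ereal (2 * pi). C z \<omega> * (z / n))"
        using f1[of z] True by (simp add: mult.assoc zero_ereal_def del: times_divide_eq_right)
      also have "\<dots> = (\<integral>\<omega>. indicator {0<..<2 * pi} \<omega> * (C z \<omega> * (z / n)) \<partial>lborel)"
        by (rule Ioo) simp
      also have "\<dots> = (\<integral>\<omega>. (indicator {h<..} z * indicator {0<..<0 + 2 * pi} \<omega> * z * (indicator D1 (?p z \<omega>) * \<Phi> (?p z \<omega>))) / n \<partial>lborel)"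
        using True D1_chart[OF \<open>h < z\<close>] \<Phi>_chart[OF \<open>h < z\<close>] \<open>h < z\<close> by (intro Bochner_Integration.integral_cong) auto
      finally show ?thesis using True by simp
    next
      case False
      then have zero: "indicator {h<..} z * indicator {0<..<0 + 2 * pi} \<omega> * z * (indicator D1 (?p z \<omega>) * \<Phi> (?p z \<omega>)) = 0" for \<omega>
        using D1_chart[of z \<omega>] by (auto simp: indicator_def)
      show ?thesis unfolding zero using False by simp
    qed
  qed
  also have "\<dots> = (\<integral>x. indicator D1 x * \<Phi> x \<partial>lborel) / n"
    using integral_polar_chart[OF int[OF D(1,2)], of h 0 c \<theta>] pos by simp
  finally have first: "(LBINT z=z0..z1. (LBINT \<omega>=0..2 * pi. C z \<omega> * f_Omega R1 R2 d h \<omega> z * f_Z R1 R2 d h z)) = \<dots>" .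

  \<comment> \<open>Starting the window at \<open>- pi\<close> makes the arc a single interval,
    which lies inside the open window because \<open>w z < pi\<close>.\<close>
  have "(LBINT z=z1..z2. (LBINT \<omega>=- w z..w z. C z \<omega> * f_Omega R1 R2 d h \<omega> z * f_Z R1 R2 d h z)) =
      (\<integral>z. (\<integral>\<omega>. indicator {h<..} z * indicator {- pi<..<- pi + 2 * pi} \<omega> * z * (indicator D2 (?p z \<omega>) * \<Phi> (?p z \<omega>)) \<partial>lborel) / n \<partial>lborel)"
    unfolding Ioc[OF z12]
  proof (intro Bochner_Integration.integral_cong refl)
    fix z
    show "indicator {z1<..z2} z * (LBINT \<omega>=- w z..w z. C z \<omega> * f_Omega R1 R2 d h \<omega> z * f_Z R1 R2 d h z) =
      (\<integral>\<omega>. indicator {h<..} z * indicator {- pi<..<- pi + 2 * pi} \<omega> * z * (indicator D2 (?p z \<omega>) * \<Phi> (?p z \<omega>)) \<partial>lborel) / n"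
    proof (cases "z1 < z \<and> z \<le> z2")
      case True
      then have "h < z" using z0 z01 by simp
      have wz: "0 \<le> w z" "w z < pi"
        unfolding w_def using omega_hat_bounds(1,2)[of h z d R1] \<open>h < z\<close> True pos dR
          le_hypotenuse_iff[of h z "R1 + d"] sqrt_less_hypotenuse_iff[of h z "R1 - d"]
        by (simp_all add: z1_def z2_def)
      have "(LBINT \<omega>=- w z..w z. C z \<omega> * f_Omega R1 R2 d h \<omega> z * f_Z R1 R2 d h z) =
          (LBINT \<omega>=- w z..w z. C z \<omega> * (z / n))"
        using f2[of z] True by (cases "w z = 0") (simp_all add: mult.assoc zero_ereal_def[symmetric] del: times_divide_eq_right)
      also have "\<dots> = (\<integral>\<omega>. indicator {- w z..w z} \<omega> * (C z \<omega> * (z / n)) \<partial>lborel)"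
        using Icc[of "- w z" "w z" "\<lambda>\<omega>. C z \<omega> * (z / n)"] wz by simp
      also have "\<dots> = (\<integral>\<omega>. (indicator {h<..} z * indicator {- pi<..<- pi + 2 * pi} \<omega> * z * (indicator D2 (?p z \<omega>) * \<Phi> (?p z \<omega>))) / n \<partial>lborel)"
        using True D2_chart[OF \<open>h < z\<close>] \<Phi>_chart[OF \<open>h < z\<close>] \<open>h < z\<close> wz
        by (intro Bochner_Integration.integral_cong) (auto simp: indicator_def)
      finally show ?thesis using True by simp
    next
      case False
      then have zero: "indicator {h<..} z * indicator {- pi<..<- pi + 2 * pi} \<omega> * z * (indicator D2 (?p z \<omega>) * \<Phi> (?p z \<omega>)) = 0" for \<omega>
        using D2_chart[of z \<omega>] by (auto simp: indicator_def abs_le_iff)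
      show ?thesis unfolding zero using False by simp
    qed
  qed
  also have "\<dots> = (\<integral>x. indicator D2 x * \<Phi> x \<partial>lborel) / n"
    using integral_polar_chart[OF int[OF D(3,4)], of h "- pi" c \<theta>] pos by simp
  finally have second: "(LBINT z=z1..z2. (LBINT \<omega>=- w z..w z. C z \<omega> * f_Omega R1 R2 d h \<omega> z * f_Z R1 R2 d h z)) = \<dots>" .
  show ?thesis
    unfolding split first[symmetric] second[symmetric]
    by (simp add: C_def conditional_coverage_def z0_def z1_def z2_def w_def)
qed

end
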